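(* Let $X_n$ be the number of correct guesses under the optimal strategy for an $n$-card deck riffle-shuffled once. Then $E[X_n]$ has an asymptotic expansion with arbitrarily many terms, one for odd $n$ and one for even $n$, as follows. There are real sequences $(c_j)_{j\ge 0}$ and $(d_j)_{j\ge 0}$ such that for every integer $K\ge 0$, as $n\to\infty$ through odd integers, $$E[X_n]=\frac n2+\sqrt{\frac{2n}{\pi}}-\frac12-\sqrt{\frac{2}{\pi n}}\left(\sum_{j=0}^{K}\frac{c_j}{n^j}+O\!\left(n^{-K-1}\right)\right),$$ with $$c_0=\frac34,\quad c_1=\frac{53}{96},\quad c_2=\frac{443}{384},\quad c_3=\frac{75949}{18432},\quad c_4=\frac{4621519}{221184},$$ and, as $n\to\infty$ through even integers, $$E[X_n]=\frac n2+\sqrt{\frac{2n}{\pi}}-\frac12-\sqrt{\frac{2}{\pi n}}\left(\sum_{j=0}^{K}\frac{d_j}{n^j}+O\!\left(n^{-K-1}\right)\right),$$ with $$d_0=\frac34,\quad d_1=\frac{49}{96},\quad d_2=\frac{439}{384},\quad d_3=\frac{76709}{18432},\quad d_4=\frac{4628519}{221184}.$$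
   Context: Riffle shuffle (Gilbert–Shannon–Reeds model): a deck of $n$ cards labeled $1,\dots,n$ from top to bottom is cut so that the top pile consists of the top $t$ cards with probability $\binom{n}{t}/2^n$ ($0\le t\le n$); then the two piles are interleaved into a single deck, keeping the relative order inside each pile, all $\binom nt$ interleavings being equally likely. Thus each pair (cut position, interleaving) has probability $2^{-n}$. Game with complete feedback: after one riffle shuffle the player guesses the cards one at a time from the top; after each guess the identity of that card is revealed. The goal is to maximize the expected number of correct guesses. Optimal strategy for one shuffle: as long as the revealed cards are $1,2,\dots,j$ (with $j\ge 0$), guess $j+1$. At the first time the revealed card is some $m\neq j+1$, the remaining deck is known to be an interleaving of the two increasing sequences $\{j+1,\dots,m-1\}$ and $\{m+1,\dots,n\}$; from then on, always guess the first (smallest) remaining card of the longer of the two remaining sequences (in case of equal lengths, the one giving the lower card number). $X_n$ is the total number of correct guesses under this strategy for a deck of $n$ cards shuffled once. *)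

theory Defs
  imports "HOL-Probability.Probability" "HOL-Library.Landau_Symbols"
begin

text \<open>
  A deck is the list of its card labels from top to bottom. The cut position is
  binomially distributed with parameter 1/2; \<^const>\<open>shuffles\<close> is the set of all interleavings
  of two lists that keep the relative order inside each of them. The labels are distinct, so
  there are \<open>n choose t\<close> interleavings and each of them is counted once.
\<close>

definition riffle_shuffle :: "nat \<Rightarrow> nat list pmf" where
  "riffle_shuffle n =
     bind_pmf (binomial_pmf n (1/2))
       (\<lambda>t. pmf_of_set (shuffles [1..<t+1] [t+1..<n+1]))"

text \<open>
  The guess for the next card of an \<open>n\<close>-card deck, given the list \<open>h\<close> of the cards revealed so
  far (so the card at position \<open>i + 1\<close> is \<open>h ! i\<close>). In the second case \<open>j\<close> is the number of
  cards revealed before the first deviation, and every label in \<open>A\<close> is smaller than every label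
  in \<open>B\<close>, so that a tie is resolved in favour of \<open>A\<close>. Both lists are empty only when
  there is no card left to guess.
\<close>

definition optimal_guess :: "nat \<Rightarrow> nat list \<Rightarrow> nat" where
  "optimal_guess n h =
     (if \<forall>i<length h. h ! i = i + 1 then length h + 1
      else let j = (LEAST i. i < length h \<and> h ! i \<noteq> i + 1);
               m = h ! j;
               A = filter (\<lambda>c. c \<notin> set h) [j+1..<m];
               B = filter (\<lambda>c. c \<notin> set h) [m+1..<n+1]
           in if length B \<le> length A then hd A else hd B)"

definition correct_guesses :: "nat \<Rightarrow> nat list \<Rightarrow> nat" where
  "correct_guesses n deck = card {i. i < n \<and> optimal_guess n (take i deck) = deck ! i}"

definition expected_correct :: "nat \<Rightarrow> real" where
  "expected_correct n =
     measure_pmf.expectation (riffle_shuffle n) (\<lambda>deck. real (correct_guesses n deck))"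

end

theory Submission
  imports Defs "HOL-Real_Asymp.Real_Asymp" "HOL-Computational_Algebra.Formal_Power_Series"
begin

text \<open>
  Encode a shuffle of \<open>n\<close> cards by a uniformly random word in \<open>{0,1}\<^sup>n\<close> that tells from which
  pile each card comes. As long as the deck starts \<open>1, 2, \<dots>\<close> every guess is right. The first
  deviation costs one guess; afterwards two increasing runs of known lengths \<open>a\<close>, \<open>b\<close> remain, and
  a guess is right with probability \<open>max a b / (a + b)\<close>. Conditioning on the first card gives
  Pascal-like recursions for the total number of correct guesses over all decks with a fixed
  cut. Summed over all cuts they collapse: if \<open>G N\<close> is the mean late score when \<open>N\<close> cards remain,
  then \<open>G (N + 1) = G N + 1/2 + (N choose N div 2) / 2\<^sup>N\<^sup>+\<^sup>1\<close>
  and \<open>E (n + 1) = (E n + G n + 1 + 1 / 2\<^sup>n) / 2\<close>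
  (\<open>tail_mean\<close> and \<open>expected_correct_Suc\<close>).

  Let \<open>p m = (2 m choose m) / 4\<^sup>m\<close>. Then \<open>G\<close> has a closed form in terms of \<open>p\<close>, one for each parity.
  After subtraction of the obvious part \<open>n/2 - 1/2 + n / 2\<^sup>n\<close> from \<open>E n\<close>, what is left at
  \<open>n = 2 m\<close> is \<open>m p(m) f(m)\<close> where \<open>f\<close> satisfies a first-order linear recurrence whose
  coefficients are polynomials in \<open>1/m\<close> (\<open>excess_ratio_rec\<close>). The square
  \<open>\<pi> m p(m)\<^sup>2\<close> satisfies such a recurrence too (\<open>central_sq_rec\<close>), and it tends to \<open>1\<close> by Wallis'
  product. The value at \<open>n = 2 m + 1\<close> is obtained from the one at \<open>2 m\<close> by one step of the recurrence
  for \<open>E\<close>; this is where the two parities get different coefficients.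

  A formal power series that solves such a recurrence formally is an asymptotic expansion of the
  actual solution. The truncated series satisfies the recurrence up to a small residual, and
  the error of the truncation is then controlled either because the recurrence contracts
  (\<open>expands_contracting_recurrence\<close>, for \<open>f\<close>) or because the solution converges and the
  residuals can be summed from infinity (\<open>expands_convergent_recurrence\<close>, for \<open>\<pi> m p(m)\<^sup>2\<close>).
  Expansions are closed under products, inverses, square roots and change of scale, so the
  expansion of \<open>E\<close> follows and its coefficients are computed in the ring of formal power series.
\<close>

unbundle no vec_syntax
unbundle fps_syntax

section \<open>Exact counting of correct guesses\<close>

text \<open>
  Recursion on the unseen part of the deck, with the history as a parameter, is what makes
  conditioning on the next card possible.
\<close>
fun hits :: "nat \<Rightarrow> nat list \<Rightarrow> nat list \<Rightarrow> nat" where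
  "hits n h [] = 0"
| "hits n h (c # cs) = of_bool (optimal_guess n h = c) + hits n (h @ [c]) cs"

lemma hits_eq_sum: "hits n h cs = (\<Sum>i<length cs. of_bool (optimal_guess n (h @ take i cs) = cs ! i))"
  by (induction n h cs rule: hits.induct) (simp_all add: sum.lessThan_Suc_shift del: sum.lessThan_Suc)

lemma correct_guesses_eq_hits:
  assumes "length deck = n"
  shows "correct_guesses n deck = hits n [] deck"
proof -
  have "correct_guesses n deck = card ({..<n} \<inter> {i. optimal_guess n (take i deck) = deck ! i})"
    unfolding correct_guesses_def by (rule arg_cong[of _ _ card]) auto
  also have "\<dots> = (\<Sum>i<n. of_bool (optimal_guess n (take i deck) = deck ! i))"
    by (simp add: sum_of_bool_eq)
  finally show ?thesis using assms by (simp add: hits_eq_sum)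
qed

lemma optimal_guess_initial: "optimal_guess n [1..<Suc j] = Suc j"
  by (simp add: optimal_guess_def del: upt_Suc)

definition first_deviation :: "nat list \<Rightarrow> nat \<Rightarrow> bool" where
  "first_deviation h j \<longleftrightarrow> j < length h \<and> h ! j \<noteq> j + 1 \<and> (\<forall>i<j. h ! i = i + 1)"

text \<open>
  Once the deck has deviated, the index of the first deviation never changes again, so the
  least element in the definition of the strategy can be evaluated for good.
\<close>
lemma optimal_guess_deviated:
  assumes "first_deviation h j"
  shows "optimal_guess n h =
    (let A = filter (\<lambda>c. c \<notin> set h) [j+1..<h ! j];
         B = filter (\<lambda>c. c \<notin> set h) [h ! j+1..<n+1]
     in if length B \<le> length A then hd A else hd B)"
proof -
  have "(LEAST i. i < length h \<and> h ! i \<noteq> i + 1) = j"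
    using assms by (intro Least_equality) (auto simp: first_deviation_def not_less[symmetric])
  moreover have "\<not> (\<forall>i<length h. h ! i = i + 1)"
    using assms by (auto simp: first_deviation_def)
  ultimately show ?thesis unfolding optimal_guess_def Let_def by (simp only: if_False)
qed

text \<open>
  The game after the first deviation, with the history replaced by the two runs of cards that
  are still to come.
\<close>
fun late_score :: "nat list \<Rightarrow> nat list \<Rightarrow> nat list \<Rightarrow> nat" where
  "late_score A B [] = 0"
| "late_score A B (c # cs) =
     of_bool ((if length B \<le> length A then hd A else hd B) = c)
     + late_score (filter (\<lambda>x. x \<noteq> c) A) (filter (\<lambda>x. x \<noteq> c) B) cs"

lemma hits_deviated:
  assumes "first_deviation h j"
  shows "hits n h cs = late_score (filter (\<lambda>c. c \<notin> set h) [j+1..<h ! j]) (filter (\<lambda>c. c \<notin> set h) [h ! j+1..<n+1]) cs"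
  using assms
proof (induction cs arbitrary: h)
  case (Cons c cs)
  have dev: "first_deviation (h @ [c]) j" and nth: "(h @ [c]) ! j = h ! j"
    using Cons.prems by (auto simp: first_deviation_def nth_append)
  have filt: "filter (\<lambda>x. x \<notin> set (h @ [c])) L = filter (\<lambda>x. x \<noteq> c) (filter (\<lambda>x. x \<notin> set h) L)" for L
    by (simp add: conj_commute)
  show ?case
    unfolding hits.simps late_score.simps optimal_guess_deviated[OF Cons.prems] Let_def
      Cons.IH[OF dev] nth filt ..
qed simp

text \<open>
  Totals over all interleavings of two runs of given lengths. In the last equation the first card
  is guessed correctly by the interleavings that start with the longer run; they are determined
  by the places of its other \<open>max a b\<close> cards among the remaining \<open>a + b + 1\<close> ones.
\<close>
fun late_total :: "nat \<Rightarrow> nat \<Rightarrow> nat" where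
  "late_total 0 b = b"
| "late_total (Suc a) 0 = Suc a"
| "late_total (Suc a) (Suc b) =
     late_total a (Suc b) + late_total (Suc a) b + (Suc (a + b) choose max a b)"

lemma sum_shuffles_Cons:
  assumes "x \<noteq> y"
  shows "(\<Sum>zs\<in>shuffles (x # xs) (y # ys). f zs) =
     (\<Sum>zs\<in>shuffles xs (y # ys). f (x # zs)) + (\<Sum>zs\<in>shuffles (x # xs) ys. (f (y # zs) :: nat))"
proof -
  have "(\<Sum>zs\<in>shuffles (x # xs) (y # ys). f zs) =
     (\<Sum>zs\<in>(#) x ` shuffles xs (y # ys). f zs) + (\<Sum>zs\<in>(#) y ` shuffles (x # xs) ys. f zs)"
    unfolding shuffles.simps using assms by (intro sum.union_disjoint) auto
  thus ?thesis by (simp add: sum.reindex o_def)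
qed

lemma filter_neq_absent: "a \<notin> set L \<Longrightarrow> filter (\<lambda>x. x \<noteq> a) L = L"
  by (induction L) auto

lemma late_score_single:
  "distinct A \<Longrightarrow> late_score A [] A = length A" "distinct B \<Longrightarrow> late_score [] B B = length B"
proof -
  show "distinct A \<Longrightarrow> late_score A [] A = length A" by (induction A) (simp_all add: filter_neq_absent)
  show "distinct B \<Longrightarrow> late_score [] B B = length B" by (induction B) (simp_all add: filter_neq_absent)
qed

lemma sum_late_score:
  assumes "distinct A" "distinct B" "set A \<inter> set B = {}"
  shows "(\<Sum>cs\<in>shuffles A B. late_score A B cs) = late_total (length A) (length B)"
  using assms
proof (induction A B rule: shuffles.induct)
  case (1 ys)
  thus ?case by (simp add: late_score_single)
next
  case (2 xs)
  thus ?case by (cases xs) (simp_all add: late_score_single del: late_score.simps)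
next
  case (3 x xs y ys)
  have xy: "x \<noteq> y" "x \<notin> set xs" "x \<notin> set ys" "y \<notin> set xs" "y \<notin> set ys" using 3 by auto
  have c1: "card (shuffles xs (y # ys)) = Suc (length xs + length ys) choose length xs"
    using 3 by (subst card_disjoint_shuffles) auto
  have c2: "card (shuffles (x # xs) ys) = Suc (length xs + length ys) choose length ys"
    using 3 by (subst card_disjoint_shuffles) (auto simp: binomial_symmetric[of "Suc (length xs)"] simp del: binomial_Suc_Suc)
  show ?case
    using 3 xy c1 c2
    by (simp add: sum_shuffles_Cons filter_neq_absent sum.distrib max_def del: shuffles.simps binomial_Suc_Suc)
qed

text \<open>
  Totals over all interleavings when no deviation has occurred yet, \<open>a\<close> cards of the top pile and
  \<open>b\<close> cards of the bottom pile being left. Starting with the top pile is a correct guess and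
  the state stays of this kind; starting with the bottom pile is the deviation.
\<close>
fun early_total :: "nat \<Rightarrow> nat \<Rightarrow> nat" where
  "early_total 0 b = b"
| "early_total (Suc a) 0 = Suc a"
| "early_total (Suc a) (Suc b) =
     (Suc (a + b) choose a) + early_total a (Suc b) + late_total (Suc a) b"

lemma hits_initial: "hits n [1..<Suc j] [Suc j..<Suc (j + b)] = b"
proof (induction b arbitrary: j)
  case (Suc b)
  have "[Suc j..<Suc (j + Suc b)] = Suc j # [Suc (Suc j)..<Suc (Suc j + b)]"
    by (simp add: upt_conv_Cons)
  moreover have "[1..<Suc j] @ [Suc j] = [1..<Suc (Suc j)]" by simp
  ultimately show ?case using Suc.IH[of "Suc j"]
    by (simp only: hits.simps optimal_guess_initial) simp
qed simp

text \<open>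
  The prefix \<open>1, \<dots>, j\<close> has been seen and the top pile ends with \<open>j + a\<close>. The total does not depend
  on \<open>j\<close>, which closes the induction on \<open>a\<close>.
\<close>
lemma sum_hits:
  "(\<Sum>cs\<in>shuffles [Suc j..<Suc (j + a)] [Suc (j + a)..<Suc (j + a + b)]. hits (j + a + b) [1..<Suc j] cs) = early_total a b"
proof (induction a arbitrary: j)
  case 0
  show ?case using hits_initial[of "j + b" j b] by simp
next
  case (Suc a)
  show ?case
  proof (cases b)
    case 0
    show ?thesis using hits_initial[of "j + Suc a" j "Suc a"] 0 by (simp del: upt_Suc)
  next
    case b: (Suc b')
    define n where "n = j + Suc a + b"
    define t where "t = j + Suc a"
    define xs where "xs = [Suc (Suc j)..<Suc t]"
    define ys where "ys = [Suc (Suc t)..<Suc n]"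
    have X: "[Suc j..<Suc t] = Suc j # xs" by (simp add: xs_def t_def upt_conv_Cons)
    have Y: "[Suc t..<Suc n] = Suc t # ys" by (simp add: ys_def n_def t_def b upt_conv_Cons)
    have snoc: "[1..<Suc j] @ [Suc j] = [1..<Suc (Suc j)]" by simp
    have dist: "distinct (Suc j # xs)" "distinct ys" "set (Suc j # xs) \<inter> set ys = {}"
      unfolding X[symmetric] by (auto simp: ys_def)
    have dist': "distinct xs" "distinct (Suc t # ys)" "set xs \<inter> set (Suc t # ys) = {}"
      unfolding Y[symmetric] by (auto simp: xs_def)
    have "j < t" by (simp add: t_def)
    have dev: "first_deviation ([1..<Suc j] @ [Suc t]) j" and nth: "([1..<Suc j] @ [Suc t]) ! j = Suc t"
      using \<open>j < t\<close> by (auto simp: first_deviation_def nth_append simp del: upt_Suc)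
    have f1: "filter (\<lambda>c. c \<notin> set ([1..<Suc j] @ [Suc t])) [j + 1..<Suc t] = Suc j # xs"
      unfolding X[symmetric] by (auto simp: filter_id_conv)
    have f2: "filter (\<lambda>c. c \<notin> set ([1..<Suc j] @ [Suc t])) [Suc t + 1..<n + 1] = ys"
      using \<open>j < t\<close> unfolding ys_def by (auto simp: filter_id_conv)
    have late: "hits n ([1..<Suc j] @ [Suc t]) cs = late_score (Suc j # xs) ys cs" for cs
      using hits_deviated[OF dev, of n cs] unfolding nth f1 f2 .
    have l: "length xs = a" "length ys = b'" by (auto simp: xs_def ys_def t_def n_def b)
    have card: "card (shuffles xs (Suc t # ys)) = Suc (a + b') choose a"
      using dist' l by (subst card_disjoint_shuffles) auto
    have "(\<Sum>cs\<in>shuffles (Suc j # xs) (Suc t # ys). hits n [1..<Suc j] cs) =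
       (\<Sum>cs\<in>shuffles xs (Suc t # ys). hits n [1..<Suc j] (Suc j # cs)) + (\<Sum>cs\<in>shuffles (Suc j # xs) ys. hits n [1..<Suc j] (Suc t # cs))"
      using \<open>j < t\<close> by (intro sum_shuffles_Cons) auto
    also have "(\<Sum>cs\<in>shuffles xs (Suc t # ys). hits n [1..<Suc j] (Suc j # cs)) =
       (Suc (a + b') choose a) + (\<Sum>cs\<in>shuffles xs (Suc t # ys). hits n [1..<Suc (Suc j)] cs)"
      unfolding hits.simps optimal_guess_initial snoc sum.distrib by (simp add: card del: upt_Suc)
    also have "(\<Sum>cs\<in>shuffles xs (Suc t # ys). hits n [1..<Suc (Suc j)] cs) = early_total a b"
      using Suc.IH[of "Suc j"] unfolding Y[symmetric] xs_def by (simp add: t_def n_def del: upt_Suc)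
    also have "(\<Sum>cs\<in>shuffles (Suc j # xs) ys. hits n [1..<Suc j] (Suc t # cs)) = late_total (Suc a) b'"
      using sum_late_score[OF dist] \<open>j < t\<close> l unfolding hits.simps optimal_guess_initial late by simp
    finally show ?thesis unfolding X[symmetric] Y[symmetric] by (simp add: n_def t_def b)
  qed
qed

text \<open>
  The sum runs through the upper half of a row of Pascal's triangle from both ends. Reflecting
  the terms below the middle turns it into the full row, with the outermost entries missing
  and the middle one counted twice.
\<close>
lemma sum_choose_max:
  "(\<Sum>a<N. N choose max a (N - 1 - a)) + 2 = 2 ^ N + (N choose (N div 2))"
proof (cases "N = 0")
  case False
  \<comment> \<open>\<open>a \<ge> N - 1 - a\<close> holds exactly for \<open>a \<ge> h\<close>, whatever the parity of \<open>N\<close>\<close>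
  define h where "h = N div 2"
  have h: "h < N" "h \<le> N" using False by (auto simp: h_def)
  have "(\<Sum>a<N. N choose max a (N - 1 - a)) = (\<Sum>a<h. N choose max a (N - 1 - a)) + (\<Sum>a=h..<N. N choose max a (N - 1 - a))"
    using h by (simp add: lessThan_atLeast0 sum.atLeastLessThan_concat)
  also have "(\<Sum>a<h. N choose max a (N - 1 - a)) = (\<Sum>a<h. N choose Suc a)"
  proof (intro sum.cong refl)
    fix a assume "a \<in> {..<h}"
    hence a: "max a (N - 1 - a) = N - Suc a" "Suc a \<le> N" using h by (auto simp: h_def)
    show "N choose max a (N - 1 - a) = N choose Suc a"
      unfolding a(1) using binomial_symmetric[OF a(2)] by simp
  qed
  also have "(\<Sum>a=h..<N. N choose max a (N - 1 - a)) = (\<Sum>a=h..<N. N choose a)"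
    by (intro sum.cong refl arg_cong2[of _ _ _ _ "(choose)"]) (auto simp: h_def)
  also have "(\<Sum>a<h. N choose Suc a) + (\<Sum>a=h..<N. N choose a) + 2 = 
      ((\<Sum>a<Suc h. N choose a) + (\<Sum>a=h..<N. N choose a)) + 1"
    by (subst sum.lessThan_Suc_shift) simp
  also have "(\<Sum>a<Suc h. N choose a) + (\<Sum>a=h..<N. N choose a) = (N choose h) + (\<Sum>a<N. N choose a)"
    using h by (simp add: lessThan_atLeast0 sum.atLeastLessThan_concat[symmetric, of 0 h N])
  also have "(N choose h) + (\<Sum>a<N. N choose a) + 1 = (N choose h) + (\<Sum>a<Suc N. N choose a)" by simp
  also have "(\<Sum>a<Suc N. N choose a) = 2 ^ N" by (simp only: lessThan_Suc_atMost choose_row_sum)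
  finally show ?thesis by (simp add: h_def)
qed simp

lemma sum_antidiagonal:
  fixes f :: "nat \<Rightarrow> nat \<Rightarrow> nat"
  shows "(\<Sum>a\<le>Suc n. f a (Suc n - a)) = f 0 (Suc n) + f (Suc n) 0 + (\<Sum>a<n. f (Suc a) (Suc (n - 1 - a)))"
proof -
  have "(\<Sum>a\<le>Suc n. f a (Suc n - a)) = f 0 (Suc n) + (\<Sum>a\<le>n. f (Suc a) (n - a))"
    by (subst sum.atMost_Suc_shift) simp
  also have "(\<Sum>a\<le>n. f (Suc a) (n - a)) = (\<Sum>a<n. f (Suc a) (n - a)) + f (Suc n) 0"
    by (simp add: lessThan_Suc_atMost[symmetric])
  also have "(\<Sum>a<n. f (Suc a) (n - a)) = (\<Sum>a<n. f (Suc a) (Suc (n - 1 - a)))"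
    by (intro sum.cong refl) (auto simp: Suc_diff_Suc)
  finally show ?thesis by simp
qed

text \<open>
  Summing over all cut positions turns the two-dimensional recursions into one-dimensional ones.
\<close>
definition late_sum :: "nat \<Rightarrow> nat" where "late_sum N = (\<Sum>a\<le>N. late_total a (N - a))"
definition early_sum :: "nat \<Rightarrow> nat" where "early_sum N = (\<Sum>a\<le>N. early_total a (N - a))"

lemma late_total_0_right: "late_total a 0 = a" by (cases a) auto
lemma early_total_0_right: "early_total a 0 = a" by (cases a) auto

lemma late_sum_split:
  "late_sum n = (\<Sum>a<n. late_total a (Suc (n - 1 - a))) + n"
  "late_sum n = n + (\<Sum>a<n. late_total (Suc a) (n - 1 - a))"
  and early_sum_split: "early_sum n = (\<Sum>a<n. early_total a (Suc (n - 1 - a))) + n"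
proof -
  have *: "(\<Sum>a\<le>n. f a (n - a)) = (\<Sum>a<n. f a (Suc (n - 1 - a))) + f n 0" for f :: "nat \<Rightarrow> nat \<Rightarrow> nat"
  proof -
    have "(\<Sum>a\<le>n. f a (n - a)) = (\<Sum>a<n. f a (n - a)) + f n 0"
      by (simp add: lessThan_Suc_atMost[symmetric])
    also have "(\<Sum>a<n. f a (n - a)) = (\<Sum>a<n. f a (Suc (n - 1 - a)))"
      by (intro sum.cong refl) (auto simp: Suc_diff_Suc)
    finally show ?thesis .
  qed
  show "late_sum n = (\<Sum>a<n. late_total a (Suc (n - 1 - a))) + n"
    unfolding late_sum_def * by (simp add: late_total_0_right)
  show "early_sum n = (\<Sum>a<n. early_total a (Suc (n - 1 - a))) + n"
    unfolding early_sum_def * by (simp add: early_total_0_right)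
  show "late_sum n = n + (\<Sum>a<n. late_total (Suc a) (n - 1 - a))"
  proof (cases n)
    case (Suc n')
    show ?thesis unfolding late_sum_def Suc sum.atMost_Suc_shift lessThan_Suc_atMost by simp
  qed (simp add: late_sum_def)
qed

lemma late_sum_Suc: "late_sum (Suc n) = 2 * late_sum n + 2 ^ n + (n choose (n div 2))"
proof -
  have "late_sum (Suc n) = 2 * Suc n + (\<Sum>a<n. late_total (Suc a) (Suc (n - 1 - a)))"
    unfolding late_sum_def sum_antidiagonal by (simp add: late_total_0_right)
  also have "(\<Sum>a<n. late_total (Suc a) (Suc (n - 1 - a))) =
     (\<Sum>a<n. late_total a (Suc (n - 1 - a))) + (\<Sum>a<n. late_total (Suc a) (n - 1 - a)) + (\<Sum>a<n. n choose max a (n - 1 - a))"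
    by (simp add: sum.distrib)
  also note * = calculation
  have "x = 2 * l + p + q" if "x = 2 * Suc n + (A + B + M)" "l = A + n" "l = n + B" "M + 2 = p + q" for x A B M l p q :: nat
    using that by presburger
  from this[OF * late_sum_split[of n] sum_choose_max] show ?thesis .
qed

lemma early_sum_Suc: "early_sum (Suc n) = early_sum n + late_sum n + 2 ^ n + 1"
proof -
  have "early_sum (Suc n) = 2 * Suc n + (\<Sum>a<n. early_total (Suc a) (Suc (n - 1 - a)))"
    unfolding early_sum_def sum_antidiagonal by (simp add: early_total_0_right)
  also have "(\<Sum>a<n. early_total (Suc a) (Suc (n - 1 - a))) =
     (\<Sum>a<n. n choose a) + (\<Sum>a<n. early_total a (Suc (n - 1 - a))) + (\<Sum>a<n. late_total (Suc a) (n - 1 - a))"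
    by (simp add: sum.distrib)
  also note * = calculation
  have row: "(\<Sum>a<n. n choose a) + 1 = 2 ^ n"
    using choose_row_sum[of n] by (simp add: lessThan_Suc_atMost[symmetric])
  have "x = e + l + p + 1" if "x = 2 * Suc n + (C + A + B)" "e = A + n" "l = n + B" "C + 1 = p" for x A B C e l p :: nat
    using that by presburger
  from this[OF * early_sum_split late_sum_split(2) row] show ?thesis .
qed

lemma expected_correct_eq: "expected_correct n = real (early_sum n) / 2 ^ n"
proof -
  define D where "D = (\<lambda>t. shuffles [1..<t+1] [t+1..<n+1])"
  have fold_D: "shuffles [1..<t+1] [t+1..<n+1] = D t" for t by (simp add: D_def)
  have len: "length deck = n" if "t \<le> n" "deck \<in> D t" for t deck
    using length_shuffles[of deck "[1..<t+1]" "[t+1..<n+1]"] that by (simp add: D_def del: upt_Suc)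
  have fin: "finite (D t)" and ne: "D t \<noteq> {}" for t
    using splice_in_shuffles[of "[1..<t+1]" "[t+1..<n+1]"] by (auto simp: D_def simp del: splice_in_shuffles)
  have card: "card (D t) = n choose t" if "t \<le> n" for t
    unfolding D_def using that by (subst card_disjoint_shuffles) (auto simp del: upt_Suc)
  have "expected_correct n = (\<Sum>t\<in>{..n}. pmf (binomial_pmf n (1/2)) t *\<^sub>R
      measure_pmf.expectation (pmf_of_set (D t)) (\<lambda>deck. real (correct_guesses n deck)))"
    unfolding expected_correct_def riffle_shuffle_def fold_D
    by (rule pmf_expectation_bind) (use fin ne in \<open>auto simp: set_pmf_binomial_eq\<close>)
  also have "\<dots> = (\<Sum>t\<le>n. real (early_total t (n - t)) / 2 ^ n)"
  proof (intro sum.cong refl)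
    fix t assume "t \<in> {..n}"
    hence t: "t \<le> n" by simp
    have "(\<Sum>deck\<in>D t. correct_guesses n deck) = (\<Sum>deck\<in>D t. hits n [] deck)"
      using len[OF t] by (intro sum.cong refl correct_guesses_eq_hits)
    also have "\<dots> = early_total t (n - t)"
      using sum_hits[of 0 t "n - t"] t by (simp add: D_def)
    finally have "(\<Sum>deck\<in>D t. real (correct_guesses n deck)) = real (early_total t (n - t))"
      by (metis of_nat_sum)
    hence "measure_pmf.expectation (pmf_of_set (D t)) (\<lambda>deck. real (correct_guesses n deck))
        = real (early_total t (n - t)) / real (n choose t)"
      using fin ne card[OF t] by (simp add: integral_pmf_of_set)
    moreover have "pmf (binomial_pmf n (1/2)) t = real (n choose t) / 2 ^ n"
      using t by (simp add: power_one_over power_add[symmetric] flip: power_divide)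
    moreover have "n choose t \<noteq> 0" using t by simp
    ultimately show "pmf (binomial_pmf n (1/2)) t *\<^sub>R
        measure_pmf.expectation (pmf_of_set (D t)) (\<lambda>deck. real (correct_guesses n deck))
        = real (early_total t (n - t)) / 2 ^ n"
      by simp
  qed
  finally show ?thesis by (simp add: early_sum_def sum_divide_distrib)
qed

text \<open>
  The mean late score \<open>late_sum N / 2\<^sup>N\<close>: the expected number of correct guesses among the last
  \<open>N\<close> cards, the deviation having occurred just before them.
\<close>
primrec tail_mean :: "nat \<Rightarrow> real" where
  "tail_mean 0 = 0"
| "tail_mean (Suc N) = tail_mean N + 1 / 2 + real (N choose (N div 2)) / 2 ^ Suc N"

lemma late_sum_eq: "real (late_sum N) = 2 ^ N * tail_mean N"
  by (induction N) (simp_all add: late_sum_def[of 0] late_sum_Suc field_simps)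

lemma expected_correct_Suc:
  "expected_correct (Suc n) = (expected_correct n + tail_mean n + 1 + 1 / 2 ^ n) / 2"
  unfolding expected_correct_eq early_sum_Suc by (simp add: late_sum_eq field_simps)

section \<open>Asymptotic expansions as formal power series\<close>

text \<open>
  Here \<open>x\<close> is the scale, a null sequence such as \<open>1/m\<close>. Keeping \<open>F\<close> a formal power series instead of
  a sequence of coefficients lets products, inverses and substitutions be done in the ring
  of formal power series.
\<close>
definition expands_upto :: "nat \<Rightarrow> (nat \<Rightarrow> real) \<Rightarrow> (nat \<Rightarrow> real) \<Rightarrow> real fps \<Rightarrow> bool" where
  "expands_upto K x f F \<longleftrightarrow> (\<lambda>m. f m - (\<Sum>k<K. F $ k * x m ^ k)) \<in> O(\<lambda>m. x m ^ K)"

definition expands :: "(nat \<Rightarrow> real) \<Rightarrow> (nat \<Rightarrow> real) \<Rightarrow> real fps \<Rightarrow> bool" where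
  "expands x f F \<longleftrightarrow> (\<forall>K. expands_upto K x f F)"

lemma expands_eventually_cong:
  assumes "expands x f F" "eventually (\<lambda>m. f m = g m) at_top"
  shows "expands x g F"
  unfolding expands_def expands_upto_def
proof
  fix K
  have "(\<lambda>m. f m - (\<Sum>k<K. F $ k * x m ^ k)) \<in> O(\<lambda>m. x m ^ K)"
    using assms by (simp add: expands_def expands_upto_def)
  moreover have "eventually (\<lambda>m. f m - (\<Sum>k<K. F $ k * x m ^ k) = g m - (\<Sum>k<K. F $ k * x m ^ k)) at_top"
    using assms(2) by eventually_elim simp
  ultimately show "(\<lambda>m. g m - (\<Sum>k<K. F $ k * x m ^ k)) \<in> O(\<lambda>m. x m ^ K)"
    by (rule landau_o.big.in_cong[THEN iffD1, rotated])
qed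

lemma expands_add:
  assumes "expands x f F" "expands x g G"
  shows "expands x (\<lambda>m. f m + g m) (F + G)"
  unfolding expands_def expands_upto_def
proof
  fix K
  have "(\<lambda>m. (f m - (\<Sum>k<K. F $ k * x m ^ k)) + (g m - (\<Sum>k<K. G $ k * x m ^ k))) \<in> O(\<lambda>m. x m ^ K)"
    using assms unfolding expands_def expands_upto_def by (intro sum_in_bigo(1)) auto
  thus "(\<lambda>m. f m + g m - (\<Sum>k<K. (F + G) $ k * x m ^ k)) \<in> O(\<lambda>m. x m ^ K)"
    by (simp add: algebra_simps sum.distrib)
qed

lemma expands_cmult:
  assumes "expands x f F"
  shows "expands x (\<lambda>m. c * f m) (fps_const c * F)"
  unfolding expands_def expands_upto_def
proof
  fix K
  have "(\<lambda>m. c * (f m - (\<Sum>k<K. F $ k * x m ^ k))) \<in> O(\<lambda>m. x m ^ K)"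
    using assms unfolding expands_def expands_upto_def by auto
  thus "(\<lambda>m. c * f m - (\<Sum>k<K. (fps_const c * F) $ k * x m ^ k)) \<in> O(\<lambda>m. x m ^ K)"
    by (simp add: algebra_simps sum_distrib_left)
qed

lemma expands_diff:
  assumes "expands x f F" "expands x g G"
  shows "expands x (\<lambda>m. f m - g m) (F - G)"
proof -
  have "F + fps_const (-1) * G = F - G" by (simp add: fps_eq_iff)
  with expands_add[OF assms(1) expands_cmult[OF assms(2), of "-1"]] show ?thesis by simp
qed

lemma expands_X_mult:
  assumes "expands x f F" "x \<longlonglongrightarrow> 0"
  shows "expands x (\<lambda>m. x m * f m) (fps_X * F)"
  unfolding expands_def expands_upto_def
proof
  fix K
  show "(\<lambda>m. x m * f m - (\<Sum>k<K. (fps_X * F) $ k * x m ^ k)) \<in> O(\<lambda>m. x m ^ K)"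
  proof (cases K)
    case 0
    have "(\<lambda>m. f m) \<in> O(\<lambda>_. 1)"
      using assms(1)[unfolded expands_def expands_upto_def, rule_format, of 0] by simp
    moreover have "x \<in> O(\<lambda>_. 1)"
      using assms(2) by (intro bigoI_tendsto[where c=0]) auto
    ultimately have "(\<lambda>m. x m * f m) \<in> O(\<lambda>_. 1 * 1)" by (intro landau_o.big.mult) auto
    thus ?thesis using 0 by simp
  next
    case (Suc L)
    have "(\<lambda>m. x m * (f m - (\<Sum>k<L. F $ k * x m ^ k))) \<in> O(\<lambda>m. x m * x m ^ L)"
      using assms unfolding expands_def expands_upto_def by (intro landau_o.big.mult) auto
    moreover have "(\<Sum>k<K. (fps_X * F) $ k * x m ^ k) = x m * (\<Sum>k<L. F $ k * x m ^ k)" for m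
      by (subst Suc, subst sum.lessThan_Suc_shift) (simp add: sum_distrib_left mult_ac)
    ultimately show ?thesis using Suc by (simp add: algebra_simps)
  qed
qed

lemma expands_const: "expands x (\<lambda>_. c) (fps_const c)"
  unfolding expands_def expands_upto_def
proof
  fix K show "(\<lambda>m. c - (\<Sum>k<K. fps_const c $ k * x m ^ k)) \<in> O(\<lambda>m. x m ^ K)"
  proof (cases K)
    case (Suc L)
    thus ?thesis by (subst Suc, subst sum.lessThan_Suc_shift) simp
  qed auto
qed

lemma expands_one: "expands x (\<lambda>_. 1) 1"
  using expands_const[of x 1] by simp

lemma expands_zero: "expands x (\<lambda>_. 0) 0"
  using expands_const[of x 0] by simp

lemma expands_sum:
  assumes "\<And>i. i \<in> I \<Longrightarrow> expands x (f i) (F i)"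
  shows "expands x (\<lambda>m. \<Sum>i\<in>I. f i m) (\<Sum>i\<in>I. F i)"
  using assms
proof (induction I rule: infinite_finite_induct)
  case (insert i I)
  have "expands x (\<lambda>m. f i m + (\<Sum>i\<in>I. f i m)) (F i + (\<Sum>i\<in>I. F i))"
    by (rule expands_add) (use insert in auto)
  with insert.hyps show ?case by simp
qed (simp_all add: expands_zero)

lemma expands_X_power_mult:
  assumes "expands x f F" "x \<longlonglongrightarrow> 0"
  shows "expands x (\<lambda>m. x m ^ i * f m) (fps_X ^ i * F)"
proof (induction i)
  case (Suc i)
  from expands_X_mult[OF this assms(2)] show ?case by (simp add: mult_ac)
qed (use assms in simp)

lemma expands_bigo:
  assumes "expands x f F" "\<And>k. k < K \<Longrightarrow> F $ k = 0"
  shows "f \<in> O(\<lambda>m. x m ^ K)"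
  using assms(1)[unfolded expands_def expands_upto_def, rule_format, of K] assms(2) by simp

lemma expands_tendsto:
  assumes "expands x f F" "x \<longlonglongrightarrow> 0"
  shows "f \<longlonglongrightarrow> F $ 0"
proof -
  have "(\<lambda>m. f m - F $ 0) \<in> O(x)"
    using assms(1)[unfolded expands_def expands_upto_def, rule_format, of 1] by simp
  also have "x \<in> o(\<lambda>_. 1)" using assms(2) by (intro smalloI_tendsto) auto
  finally have "(\<lambda>m. (f m - F $ 0) / 1) \<longlonglongrightarrow> 0" by (rule smalloD_tendsto)
  thus ?thesis by (simp add: LIM_zero_iff)
qed

lemma expands_truncation:
  assumes "x \<longlonglongrightarrow> 0"
  shows "expands x (\<lambda>m. \<Sum>k<K. F $ k * x m ^ k) (\<Sum>k<K. fps_const (F $ k) * fps_X ^ k)"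
  using expands_sum[of "{..<K}" x "\<lambda>k m. F $ k * x m ^ k" "\<lambda>k. fps_const (F $ k) * fps_X ^ k"]
    expands_cmult[OF expands_X_power_mult[OF expands_one assms]] by simp

lemma truncation_nth: "(\<Sum>k<K. fps_const (F $ k) * fps_X ^ k) $ n = (if n < K then F $ n else (0::real))"
  by (simp add: fps_sum_nth if_distrib[of "\<lambda>z. _ * z"] cong: if_cong)

lemma fps_mult_nth_cong_below:
  fixes F :: "real fps"
  assumes "\<And>i. i < K \<Longrightarrow> F $ i = F' $ i" "\<And>i. i < K \<Longrightarrow> G $ i = G' $ i" "k < K"
  shows "(F * G) $ k = (F' * G') $ k"
  unfolding fps_mult_nth using assms by (intro sum.cong refl) auto

text \<open>
  An expansion up to order \<open>K\<close> may be checked on any approximation of \<open>f\<close> that is good to this order and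
  has a known expansion. In the closure properties below, \<open>g\<close> arises by truncating one of
  the series involved, which leaves finite sums only.
\<close>
lemma expands_upto_perturb:
  assumes "(\<lambda>m. f m - g m) \<in> O(\<lambda>m. x m ^ K)" "expands x g G" "\<And>k. k < K \<Longrightarrow> G $ k = F $ k"
  shows "expands_upto K x f F"
proof -
  have "(\<Sum>k<K. F $ k * x m ^ k) = (\<Sum>k<K. G $ k * x m ^ k)" for m
    using assms(3) by (intro sum.cong) auto
  moreover have "(\<lambda>m. (f m - g m) + (g m - (\<Sum>k<K. G $ k * x m ^ k))) \<in> O(\<lambda>m. x m ^ K)"
    using assms(1,2) unfolding expands_def expands_upto_def
    by (intro sum_in_bigo(1)) auto
  ultimately show ?thesis by (simp add: expands_upto_def)
qed

lemma expands_mult: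
  assumes x: "x \<longlonglongrightarrow> 0" and f: "expands x f F" and g: "expands x g G"
  shows "expands x (\<lambda>m. f m * g m) (F * G)"
  unfolding expands_def
proof
  fix K
  define P where "P = (\<lambda>m. \<Sum>k<K. F $ k * x m ^ k)"
  have "g \<in> O(\<lambda>m. x m ^ 0)" using g by (rule expands_bigo) auto
  hence *: "(\<lambda>m. (f m - P m) * g m) \<in> O(\<lambda>m. x m ^ K * x m ^ 0)"
    using f unfolding P_def expands_def expands_upto_def by (intro landau_o.big.mult) auto
  have "expands x (\<lambda>m. \<Sum>k<K. F $ k * (x m ^ k * g m)) (\<Sum>k<K. fps_const (F $ k) * (fps_X ^ k * G))"
    by (intro expands_sum expands_cmult expands_X_power_mult x g)
  hence **: "expands x (\<lambda>m. P m * g m) ((\<Sum>k<K. fps_const (F $ k) * fps_X ^ k) * G)"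
    by (simp add: P_def sum_distrib_right sum_distrib_left mult_ac)
  show "expands_upto K x (\<lambda>m. f m * g m) (F * G)"
  proof (rule expands_upto_perturb[OF _ **])
    show "(\<lambda>m. f m * g m - P m * g m) \<in> O(\<lambda>m. x m ^ K)"
      using * by (simp add: algebra_simps)
  qed (auto intro!: fps_mult_nth_cong_below[of K] simp: truncation_nth)
qed

lemma expands_power:
  assumes "x \<longlonglongrightarrow> 0" "expands x f F"
  shows "expands x (\<lambda>m. f m ^ i) (F ^ i)"
proof (induction i)
  case (Suc i)
  from expands_mult[OF assms Suc] show ?case by simp
qed (simp add: expands_one)

text \<open>
  If \<open>P\<close> is the truncation of the inverse series, then \<open>f P\<close> differs from \<open>1\<close> by \<open>O(x\<^sup>K)\<close>;
  dividing by \<open>f\<close>, which stays away from \<open>0\<close>, preserves this.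
\<close>
lemma expands_inverse:
  assumes x: "x \<longlonglongrightarrow> 0" and f: "expands x f F" and F0: "F $ 0 \<noteq> 0"
  shows "expands x (\<lambda>m. inverse (f m)) (inverse F)"
  unfolding expands_def
proof
  fix K
  define G where "G = inverse F"
  define P where "P = (\<lambda>m. \<Sum>k<K. G $ k * x m ^ k)"
  note cut = expands_truncation[OF x, where K = K and F = G, folded P_def]
  have lim: "f \<longlonglongrightarrow> F $ 0" using expands_tendsto[OF f x] .
  have "(\<lambda>m. 1 - f m * P m) \<in> O(\<lambda>m. x m ^ K)"
  proof (rule expands_bigo[OF expands_diff[OF expands_one expands_mult[OF x f cut]]])
    fix k assume "k < K"
    hence "(F * (\<Sum>k<K. fps_const (G $ k) * fps_X ^ k)) $ k = (F * G) $ k"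
      by (intro fps_mult_nth_cong_below) (auto simp: truncation_nth)
    also have "F * G = 1" unfolding G_def using F0 by (simp add: inverse_mult_eq_1')
    finally show "(1 - F * (\<Sum>k<K. fps_const (G $ k) * fps_X ^ k)) $ k = 0" by simp
  qed
  moreover have "(\<lambda>m. inverse (f m)) \<in> O(\<lambda>_. 1)"
    by (rule bigoI_tendsto[where c = "inverse (F $ 0)"]) (use tendsto_inverse[OF lim F0] in auto)
  ultimately have "(\<lambda>m. inverse (f m) * (1 - f m * P m)) \<in> O(\<lambda>m. 1 * x m ^ K)"
    by (rule landau_o.big.mult[rotated])
  moreover have "eventually (\<lambda>m. f m \<noteq> 0) at_top"
    using lim F0 by (rule tendsto_imp_eventually_ne)
  hence "eventually (\<lambda>m. inverse (f m) * (1 - f m * P m) = inverse (f m) - P m) at_top"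
    by eventually_elim (simp add: field_simps)
  ultimately have "(\<lambda>m. inverse (f m) - P m) \<in> O(\<lambda>m. x m ^ K)"
    by (simp add: landau_o.big.in_cong)
  thus "expands_upto K x (\<lambda>m. inverse (f m)) (inverse F)"
    by (simp add: expands_upto_def P_def G_def)
qed

text \<open>
  Since \<open>sqrt f - P = (f - P\<^sup>2) / (sqrt f + P)\<close> and the denominator has a positive limit, it is
  enough to compare \<open>f\<close> with the square of the truncation.
\<close>
lemma expands_sqrt:
  assumes x: "x \<longlonglongrightarrow> 0" and f: "expands x f (S * S)" and S0: "S $ 0 > 0"
  shows "expands x (\<lambda>m. sqrt (f m)) S"
  unfolding expands_def
proof
  fix K
  define P where "P = (\<lambda>m. \<Sum>k<K. S $ k * x m ^ k)"
  define Q where "Q = (\<Sum>k<K. fps_const (S $ k) * fps_X ^ k)"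
  have cut: "expands x P Q" unfolding P_def Q_def by (rule expands_truncation[OF x])
  have Q: "Q $ k = (if k < K then S $ k else 0)" for k
    unfolding Q_def by (rule truncation_nth)
  define c where "c = S $ 0 + Q $ 0"
  have c: "c > 0" using S0 by (simp add: c_def Q)
  have limf: "f \<longlonglongrightarrow> S $ 0 * S $ 0" using expands_tendsto[OF f x] by simp
  have "(\<lambda>m. sqrt (f m) + P m) \<longlonglongrightarrow> sqrt (S $ 0 * S $ 0) + Q $ 0"
    by (intro tendsto_intros limf expands_tendsto[OF cut x])
  hence lim: "(\<lambda>m. sqrt (f m) + P m) \<longlonglongrightarrow> c" using S0 by (simp add: c_def)
  have "(\<lambda>m. f m - P m * P m) \<in> O(\<lambda>m. x m ^ K)"
  proof (rule expands_bigo[OF expands_diff[OF f expands_mult[OF x cut cut]]])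
    fix k assume "k < K"
    hence "(Q * Q) $ k = (S * S) $ k"
      by (intro fps_mult_nth_cong_below[of K]) (auto simp: Q)
    thus "(S * S - Q * Q) $ k = 0" by simp
  qed
  moreover have "(\<lambda>m. inverse (sqrt (f m) + P m)) \<in> O(\<lambda>_. 1)"
    by (rule bigoI_tendsto[where c = "inverse c"]) (use tendsto_inverse[OF lim] c in auto)
  ultimately have "(\<lambda>m. inverse (sqrt (f m) + P m) * (f m - P m * P m)) \<in> O(\<lambda>m. 1 * x m ^ K)"
    by (rule landau_o.big.mult[rotated])
  moreover have "eventually (\<lambda>m. inverse (sqrt (f m) + P m) * (f m - P m * P m) = sqrt (f m) - P m) at_top"
  proof -
    have "eventually (\<lambda>m. f m > 0) at_top"
      using limf by (rule order_tendstoD) (use S0 in auto)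
    moreover have "eventually (\<lambda>m. sqrt (f m) + P m \<noteq> 0) at_top"
      using lim by (rule tendsto_imp_eventually_ne) (use c in auto)
    ultimately show ?thesis
    proof eventually_elim
      case (elim m)
      have "f m - P m * P m = (sqrt (f m) + P m) * (sqrt (f m) - P m)"
        using elim by (simp add: algebra_simps)
      with elim show ?case by simp
    qed
  qed
  ultimately have "(\<lambda>m. sqrt (f m) - P m) \<in> O(\<lambda>m. x m ^ K)"
    by (simp add: landau_o.big.in_cong)
  thus "expands_upto K x (\<lambda>m. sqrt (f m)) S"
    by (simp add: expands_upto_def P_def)
qed

lemma fps_power_nth_below:
  fixes G :: "real fps"
  assumes "G $ 0 = 0" "n < i"
  shows "(G ^ i) $ n = 0"
  using startsby_zero_power_prefix[of G i] assms by simp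

text \<open>
  Change of scale: the passage from \<open>1/(m+1)\<close> to \<open>1/m\<close> and that from \<open>1/m\<close> to \<open>1/n\<close> with
  \<open>n = 2 m\<close> or \<open>n = 2 m + 1\<close> are both instances.
\<close>
lemma expands_compose:
  assumes x: "x \<longlonglongrightarrow> 0" and f: "expands y f F" and y: "expands x y G" and G0: "G $ 0 = 0"
  shows "expands x f (F oo G)"
  unfolding expands_def
proof
  fix K
  have yx: "y \<in> O(x)" using expands_bigo[OF y, of 1] G0 by simp
  have e: "expands x (\<lambda>m. \<Sum>i<K. F $ i * y m ^ i) (\<Sum>i<K. fps_const (F $ i) * G ^ i)"
    by (intro expands_sum expands_cmult expands_power x y)
  show "expands_upto K x f (F oo G)"
  proof (rule expands_upto_perturb[OF _ e])
    have "(\<lambda>m. f m - (\<Sum>i<K. F $ i * y m ^ i)) \<in> O(\<lambda>m. y m ^ K)"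
      using f by (simp add: expands_def expands_upto_def)
    also have "(\<lambda>m. y m ^ K) \<in> O(\<lambda>m. x m ^ K)" using yx by (rule landau_o.big_power)
    finally show "(\<lambda>m. f m - (\<Sum>i<K. F $ i * y m ^ i)) \<in> O(\<lambda>m. x m ^ K)" .
    fix k assume k: "k < K"
    have "(\<Sum>i<K. fps_const (F $ i) * G ^ i) $ k = (\<Sum>i<K. F $ i * (G ^ i) $ k)"
      by (simp add: fps_sum_nth)
    also have "\<dots> = (\<Sum>i\<in>{0..k}. F $ i * (G ^ i) $ k)"
      using k G0 by (intro sum.mono_neutral_right) (auto intro: fps_power_nth_below)
    finally show "(\<Sum>i<K. fps_const (F $ i) * G ^ i) $ k = (F oo G) $ k" by (simp add: fps_compose_nth)
  qed
qed

section \<open>Expansions of solutions of first-order recurrences\<close>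

text \<open>
  The series of \<open>a x / (1 + b x)\<close>. All changes of scale in the proof have this form:
  \<open>1/(m+1)\<close> in terms of \<open>1/m\<close>, and \<open>1/m\<close> in terms of \<open>1/(2 m)\<close> or \<open>1/(2 m + 1)\<close>.
\<close>
definition moebius :: "real \<Rightarrow> real \<Rightarrow> real fps" where
  "moebius a b = fps_const a * fps_X * inverse (1 + fps_const b * fps_X)"

lemma moebius_nth_0 [simp]: "moebius a b $ 0 = 0"
  by (simp add: moebius_def)

text \<open>
  Compare coefficients in \<open>(1 + b X) M\<^sup>i\<^sup>+\<^sup>1 = a X M\<^sup>i\<close>.
\<close>
lemma moebius_power_Suc_nth:
  "(moebius a b ^ Suc i) $ n =
     (case n of 0 \<Rightarrow> 0 | Suc n' \<Rightarrow> a * (moebius a b ^ i) $ n' - b * (moebius a b ^ Suc i) $ n')"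
proof (cases n)
  case (Suc n')
  have "moebius a b * (1 + fps_const b * fps_X) = fps_const a * fps_X"
    by (simp add: moebius_def mult.assoc inverse_mult_eq_1)
  hence "moebius a b ^ i * (moebius a b * (1 + fps_const b * fps_X)) = moebius a b ^ i * (fps_const a * fps_X)"
    by simp
  hence "moebius a b ^ Suc i = fps_X * (fps_const a * moebius a b ^ i - fps_const b * moebius a b ^ Suc i)"
    by (simp add: algebra_simps)
  hence "(moebius a b ^ Suc i) $ Suc n' = (fps_X * (fps_const a * moebius a b ^ i - fps_const b * moebius a b ^ Suc i)) $ Suc n'"
    by (rule arg_cong)
  also have "\<dots> = (fps_const a * moebius a b ^ i - fps_const b * moebius a b ^ Suc i) $ n'"
    by (simp only: fps_X_mult_nth) simp
  finally show ?thesis using Suc by simp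
qed simp

lemma moebius_power_nth_diag: "(moebius 1 b ^ n) $ n = 1"
proof (induction n)
  case (Suc n)
  have "(moebius 1 b ^ Suc n) $ n = 0" by (rule fps_power_nth_below) auto
  with Suc show ?case by (simp add: moebius_power_Suc_nth del: power_Suc)
qed simp

lemma moebius_power_nth_Suc_diag: "(moebius 1 1 ^ n) $ Suc n = - real n"
proof (induction n)
  case (Suc n)
  thus ?case using moebius_power_nth_diag[of 1 "Suc n"]
    by (subst moebius_power_Suc_nth) (simp del: power_Suc)
qed simp

lemma expands_id: "x \<longlonglongrightarrow> 0 \<Longrightarrow> expands x x fps_X"
  using expands_X_mult[OF expands_one, of x] by simp

lemma expands_moebius:
  assumes x: "x \<longlonglongrightarrow> 0"
  shows "expands x (\<lambda>m. a * x m / (1 + b * x m)) (moebius a b)"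
proof -
  have "expands x (\<lambda>m. a * x m * inverse (1 + b * x m)) (moebius a b)"
    unfolding moebius_def
    by (intro expands_mult[OF x] expands_cmult expands_id[OF x] expands_inverse[OF x] expands_add expands_one) simp
  thus ?thesis by (simp add: field_simps)
qed

abbreviation recip :: "nat \<Rightarrow> real" where "recip m \<equiv> 1 / real m"

lemma recip_lim: "recip \<longlonglongrightarrow> 0"
  by real_asymp

lemma expands_recip_Suc: "expands recip (\<lambda>m. recip (Suc m)) (moebius 1 1)"
proof (rule expands_eventually_cong[OF expands_moebius[OF recip_lim]])
  show "\<forall>\<^sub>F m in sequentially. 1 * recip m / (1 + 1 * recip m) = recip (Suc m)"
    using eventually_gt_at_top[of 0] by eventually_elim (simp add: field_simps)
qed

fun triangular_solution :: "(nat \<Rightarrow> nat \<Rightarrow> real) \<Rightarrow> (nat \<Rightarrow> real) \<Rightarrow> nat \<Rightarrow> real" where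
  "triangular_solution w c n = (c n - (\<Sum>i<n. triangular_solution w c i * w i n)) / w n n"

declare triangular_solution.simps [simp del]

lemma triangular_system_solvable:
  fixes w :: "nat \<Rightarrow> nat \<Rightarrow> real"
  assumes "\<And>n. w n n \<noteq> 0"
  shows "\<exists>F. \<forall>n. (\<Sum>i\<le>n. F i * w i n) = c n"
proof (intro exI allI)
  fix n
  show "(\<Sum>i\<le>n. triangular_solution w c i * w i n) = c n"
    using assms[of n]
    by (simp add: lessThan_Suc_atMost[symmetric] triangular_solution.simps[of w c n])
qed

text \<open>
  Inserting \<open>f m = m\<^sup>-\<^sup>i\<close> into \<open>\<alpha> m * f (m + 1) - \<beta> m * f m\<close> gives the series
  \<open>A M\<^sup>i - B X\<^sup>i\<close> with \<open>M = X / (1 + X)\<close>. Its coefficients vanish below index \<open>i\<close>, so a formal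
  solution of the recurrence is the solution of a triangular linear system.
\<close>
definition shift_coeff :: "real fps \<Rightarrow> real fps \<Rightarrow> nat \<Rightarrow> nat \<Rightarrow> real" where
  "shift_coeff A B i n = (A * moebius 1 1 ^ i - B * fps_X ^ i) $ n"

lemma shift_coeff_below:
  assumes "n < i"
  shows "shift_coeff A B i n = 0"
proof -
  have "(A * moebius 1 1 ^ i) $ n = (\<Sum>j=0..n. A $ j * (moebius 1 1 ^ i) $ (n - j))"
    by (rule fps_mult_nth)
  also have "\<dots> = 0" using assms by (intro sum.neutral) (auto intro!: fps_power_nth_below)
  finally show ?thesis using assms by (simp add: shift_coeff_def fps_X_power_mult_right_nth)
qed

lemma shift_coeff_diag: "shift_coeff A B n n = A $ 0 - B $ 0"
proof -
  have "(A * moebius 1 1 ^ n) $ n = (\<Sum>j=0..n. A $ j * (moebius 1 1 ^ n) $ (n - j))"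
    by (rule fps_mult_nth)
  also have "\<dots> = (\<Sum>j\<in>{0}. A $ j * (moebius 1 1 ^ n) $ (n - j))"
    by (intro sum.mono_neutral_right) (auto intro!: fps_power_nth_below)
  finally show ?thesis by (simp add: shift_coeff_def fps_X_power_mult_right_nth moebius_power_nth_diag)
qed

lemma shift_coeff_Suc_diag: "shift_coeff A B n (Suc n) = A $ 1 - B $ 1 - real n * A $ 0"
proof -
  have "(A * moebius 1 1 ^ n) $ Suc n = (\<Sum>j=0..Suc n. A $ j * (moebius 1 1 ^ n) $ (Suc n - j))"
    by (rule fps_mult_nth)
  also have "\<dots> = (\<Sum>j\<in>{0,1}. A $ j * (moebius 1 1 ^ n) $ (Suc n - j))"
    by (intro sum.mono_neutral_right) (auto intro!: fps_power_nth_below)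
  finally show ?thesis
    by (simp add: shift_coeff_def fps_X_power_mult_right_nth moebius_power_nth_diag moebius_power_nth_Suc_diag)
qed

lemma expands_residual:
  assumes A: "expands recip \<alpha> A" and B: "expands recip \<beta> B"
  shows "expands recip
     (\<lambda>m. \<alpha> m * (\<Sum>i<K. F i * recip (Suc m) ^ i) - \<beta> m * (\<Sum>i<K. F i * recip m ^ i))
     (\<Sum>i<K. fps_const (F i) * (A * moebius 1 1 ^ i - B * fps_X ^ i))"
proof -
  have "expands recip
     (\<lambda>m. \<Sum>i<K. F i * (\<alpha> m * recip (Suc m) ^ i - \<beta> m * recip m ^ i))
     (\<Sum>i<K. fps_const (F i) * (A * moebius 1 1 ^ i - B * fps_X ^ i))"
    by (intro expands_sum expands_cmult expands_diff expands_mult[OF recip_lim] A B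
          expands_power[OF recip_lim] expands_recip_Suc expands_id[OF recip_lim])
  thus ?thesis by (simp add: sum_subtractf sum_distrib_left algebra_simps)
qed

lemma residual_series_nth:
  "(\<Sum>i<K. fps_const (F i) * (A * moebius 1 1 ^ i - B * fps_X ^ i)) $ n = (\<Sum>i<K. F i * shift_coeff A B i n)"
  by (simp only: fps_sum_nth fps_mult_left_const_nth shift_coeff_def)

lemma sum_shift_coeff_truncate:
  assumes "n < K"
  shows "(\<Sum>i<K. F i * shift_coeff A B i n) = (\<Sum>i\<le>n. F i * shift_coeff A B i n)"
  using assms by (intro sum.mono_neutral_right) (auto simp: shift_coeff_below)

text \<open>
  The error multiplied by \<open>m\<^sup>K\<close> satisfies \<open>v (m + 1) \<le> q v m + C'\<close> with \<open>q < 1\<close>, since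
  the factor \<open>((m + 1)/m)\<^sup>K\<close> tends to \<open>1\<close>; hence it is bounded.
\<close>
lemma contraction_bigo:
  assumes a: "\<alpha> \<longlonglongrightarrow> a" and b: "\<beta> \<longlonglongrightarrow> b" and ab: "\<bar>b\<bar> < \<bar>a\<bar>"
    and rho: "(\<lambda>m. \<alpha> m * e (Suc m) - \<beta> m * e m) \<in> O(\<lambda>m. recip m ^ K)"
  shows "e \<in> O(\<lambda>m. recip m ^ K)"
proof -
  from ab have a0: "a \<noteq> 0" by auto
  obtain C where C: "C > 0"
    "eventually (\<lambda>m. norm (\<alpha> m * e (Suc m) - \<beta> m * e m) \<le> C * norm (recip m ^ K)) at_top"
    using rho by (rule landau_o.bigE)
  define r where "r = (\<lambda>m. (real (Suc m) / real m) ^ K)"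
  have r: "r \<longlonglongrightarrow> 1"
  proof -
    have "(\<lambda>m. real (Suc m) / real m) \<longlonglongrightarrow> 1" by real_asymp
    from tendsto_power[OF this, of K] show ?thesis by (simp add: r_def)
  qed
  \<comment> \<open>any number strictly between the limiting ratio and \<open>1\<close>\<close>
  define q where "q = (\<bar>b\<bar> / \<bar>a\<bar> + 1) / 2"
  have q: "\<bar>b\<bar> / \<bar>a\<bar> < q" "q < 1" "0 \<le> q" using ab by (auto simp: q_def field_simps)
  define C' where "C' = C / \<bar>a\<bar> + 1"
  have "(\<lambda>m. \<bar>\<beta> m\<bar> / \<bar>\<alpha> m\<bar> * r m) \<longlonglongrightarrow> \<bar>b\<bar> / \<bar>a\<bar> * 1"
    by (intro tendsto_intros a b r) (use a0 in auto)
  hence ev1: "eventually (\<lambda>m. \<bar>\<beta> m\<bar> / \<bar>\<alpha> m\<bar> * r m < q) at_top"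
    by (rule order_tendstoD) (use q in auto)
  have "(\<lambda>m. C / \<bar>\<alpha> m\<bar> * r m) \<longlonglongrightarrow> C / \<bar>a\<bar> * 1"
    by (intro tendsto_intros a r) (use a0 in auto)
  hence ev2: "eventually (\<lambda>m. C / \<bar>\<alpha> m\<bar> * r m < C') at_top"
    by (rule order_tendstoD) (auto simp: C'_def)
  have ev3: "eventually (\<lambda>m. \<alpha> m \<noteq> 0) at_top" using a a0 by (rule tendsto_imp_eventually_ne)
  \<comment> \<open>the error, rescaled so that the claim becomes its boundedness\<close>
  define v where "v = (\<lambda>m. \<bar>e m\<bar> * real m ^ K)"
  have "eventually (\<lambda>m. v (Suc m) \<le> q * v m + C') at_top"
    using C(2) ev1 ev2 ev3 eventually_gt_at_top[of 0]
  proof eventually_elim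
    case (elim m)
    have rm: "real (Suc m) ^ K = r m * real m ^ K" using elim by (simp add: r_def power_divide)
    have "\<bar>\<alpha> m\<bar> * \<bar>e (Suc m)\<bar> \<le> \<bar>\<beta> m\<bar> * \<bar>e m\<bar> + C * recip m ^ K"
    proof -
      have "\<bar>\<alpha> m * e (Suc m)\<bar> \<le> \<bar>\<alpha> m * e (Suc m) - \<beta> m * e m\<bar> + \<bar>\<beta> m * e m\<bar>" by linarith
      thus ?thesis using elim(1) by (simp add: abs_mult)
    qed
    hence "\<bar>e (Suc m)\<bar> \<le> (\<bar>\<beta> m\<bar> * \<bar>e m\<bar> + C * recip m ^ K) / \<bar>\<alpha> m\<bar>"
      using elim by (simp add: field_simps)
    hence "v (Suc m) \<le> (\<bar>\<beta> m\<bar> * \<bar>e m\<bar> + C * recip m ^ K) / \<bar>\<alpha> m\<bar> * (r m * real m ^ K)"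
      unfolding v_def rm by (intro mult_right_mono) (auto simp: r_def)
    also have "\<dots> = (\<bar>\<beta> m\<bar> / \<bar>\<alpha> m\<bar> * r m) * v m + C / \<bar>\<alpha> m\<bar> * r m"
      using elim by (simp add: v_def field_simps)
    also have "\<dots> \<le> q * v m + C'"
      using elim by (intro add_mono mult_right_mono) (auto simp: v_def)
    finally show ?case .
  qed
  then obtain M where M: "\<And>m. m \<ge> M \<Longrightarrow> v (Suc m) \<le> q * v m + C'"
    by (auto simp: eventually_at_top_linorder)
  \<comment> \<open>\<open>C' / (1 - q)\<close> is the fixed point of \<open>v \<mapsto> q v + C'\<close>\<close>
  define D where "D = max (v M) (C' / (1 - q))"
  have D: "q * D + C' \<le> D"
  proof -
    have "C' / (1 - q) \<le> D" by (simp add: D_def)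
    hence "C' \<le> D * (1 - q)" using q by (simp add: field_simps)
    thus ?thesis by (simp add: algebra_simps)
  qed
  have vD: "v m \<le> D" if "m \<ge> M" for m
    using that
  proof (induction m rule: dec_induct)
    case base show ?case by (simp add: D_def)
  next
    case (step m)
    have "v (Suc m) \<le> q * v m + C'" by (rule M) (use step in auto)
    also have "\<dots> \<le> q * D + C'" using step q by (intro add_mono mult_left_mono) auto
    finally show ?case using D by simp
  qed
  show ?thesis
  proof (rule bigoI)
    show "eventually (\<lambda>m. norm (e m) \<le> D * norm (recip m ^ K)) at_top"
      using eventually_ge_at_top[of M] eventually_gt_at_top[of 0]
    proof eventually_elim
      case (elim m)
      from vD[OF elim(1)] elim(2) show ?case by (simp add: v_def field_simps)
    qed
  qed
qed

text \<open>
  The residuals are of order \<open>m\<^sup>-\<^sup>K\<^sup>-\<^sup>1\<close>, their tail sums of order \<open>m\<^sup>-\<^sup>K\<close>. Instead of summing, one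
  compares with \<open>2 C m\<^sup>-\<^sup>K\<close>, whose decrements dominate the residuals: the difference
  is then nondecreasing with limit \<open>0\<close>.
\<close>
lemma telescoping_bigo:
  assumes lim: "e \<longlonglongrightarrow> 0" and K: "K > 0" and C: "C \<ge> 0"
    and rec: "eventually (\<lambda>m. \<bar>e m\<bar> \<le> \<bar>e (Suc m)\<bar> + C * recip m ^ Suc K) at_top"
  shows "e \<in> O(\<lambda>m. recip m ^ K)"
proof -
  define u where "u = (\<lambda>m. \<bar>e m\<bar> - 2 * C * recip m ^ K)"
  have step: "C * recip m ^ Suc K \<le> 2 * C * recip m ^ K - 2 * C * recip (Suc m) ^ K" if "m > 0" for m
  proof -
    have "(recip (Suc m) / recip m) ^ K \<le> (recip (Suc m) / recip m) ^ 1"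
      using K that by (intro power_decreasing) (auto simp: field_simps)
    hence "recip m ^ K * (recip (Suc m) / recip m) ^ K \<le> recip m ^ K * (recip (Suc m) / recip m)"
      by (intro mult_left_mono) auto
    moreover have "recip m ^ K * (recip (Suc m) / recip m) ^ K = recip (Suc m) ^ K"
      unfolding power_mult_distrib[symmetric] using that by simp
    moreover have "recip (Suc m) / recip m = real m / (real m + 1)" by (simp add: add.commute)
    ultimately have "recip (Suc m) ^ K \<le> recip m ^ K * (real m / (real m + 1))"
      by (simp only:)
    moreover have "real m / (real m + 1) = 1 - 1 / (real m + 1)" by (simp add: field_simps)
    ultimately have "recip m ^ K - recip (Suc m) ^ K \<ge> recip m ^ K * (1 / (real m + 1))"
      by (simp only: right_diff_distrib)
    moreover have "recip m ^ K * (1 / (real m + 1)) \<ge> recip m ^ K * (recip m / 2)"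
      using that by (intro mult_left_mono) (auto simp: field_simps)
    ultimately have "recip m ^ Suc K \<le> 2 * (recip m ^ K - recip (Suc m) ^ K)" by simp
    from mult_left_mono[OF this C] show ?thesis by (simp add: algebra_simps)
  qed
  obtain M where M: "\<And>m. m \<ge> M \<Longrightarrow> \<bar>e m\<bar> \<le> \<bar>e (Suc m)\<bar> + C * recip m ^ Suc K"
    using rec by (auto simp: eventually_at_top_linorder)
  have recip_pow: "(\<lambda>m. recip m ^ K) \<longlonglongrightarrow> 0"
    using tendsto_power[OF recip_lim, of K] K by (simp add: power_0_left)
  have ulim: "u \<longlonglongrightarrow> \<bar>0\<bar> - 2 * C * 0"
    unfolding u_def by (intro tendsto_diff tendsto_rabs tendsto_mult tendsto_const lim recip_pow)
  have le: "u m \<le> 0" if m: "m \<ge> Suc M" for m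
  proof -
    have "u (m + k) \<le> u (Suc (m + k))" for k
      using M[of "m + k"] step[of "m + k"] m unfolding u_def by simp
    hence "incseq (\<lambda>k. u (m + k))" by (intro incseq_SucI) simp
    moreover have "(\<lambda>k. u (m + k)) \<longlonglongrightarrow> 0"
      using LIMSEQ_ignore_initial_segment[OF ulim, of m] by (simp add: add.commute)
    ultimately have "u (m + 0) \<le> 0" by (rule incseq_le)
    thus ?thesis by simp
  qed
  show ?thesis
  proof (rule bigoI)
    show "eventually (\<lambda>m. norm (e m) \<le> (2 * C) * norm (recip m ^ K)) at_top"
      using eventually_ge_at_top[of "Suc M"]
      by eventually_elim (use le in \<open>auto simp: u_def\<close>)
  qed
qed

text \<open>
  The diagonal of the triangular system is the constant \<open>A $ 0 - B $ 0\<close>, so the formal solution is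
  unique, and the initial value of \<open>f\<close> has no influence on its expansion.
\<close>
lemma expands_contracting_recurrence:
  assumes A: "expands recip \<alpha> A" and B: "expands recip \<beta> B" and C: "expands recip \<gamma> C"
    and AB: "\<bar>B $ 0\<bar> < \<bar>A $ 0\<bar>"
    and rec: "eventually (\<lambda>m. \<alpha> m * f (Suc m) = \<beta> m * f m + \<gamma> m) at_top"
  shows "\<exists>F. expands recip f F \<and> (\<forall>n. (\<Sum>i\<le>n. F $ i * shift_coeff A B i n) = C $ n)"
proof -
  have "shift_coeff A B n n \<noteq> 0" for n using AB by (simp add: shift_coeff_diag)
  then obtain c where c: "\<And>n. (\<Sum>i\<le>n. c i * shift_coeff A B i n) = C $ n"
    using triangular_system_solvable[of "shift_coeff A B" "\<lambda>n. C $ n"] by blast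
  have "expands_upto K recip f (Abs_fps c)" for K
  proof -
    define P where "P = (\<lambda>m. \<Sum>i<K. c i * recip m ^ i)"
    have "expands recip (\<lambda>m. (\<alpha> m * P (Suc m) - \<beta> m * P m) - \<gamma> m)
       ((\<Sum>i<K. fps_const (c i) * (A * moebius 1 1 ^ i - B * fps_X ^ i)) - C)"
      unfolding P_def by (intro expands_diff[OF expands_residual[OF A B] C])
    hence "(\<lambda>m. (\<alpha> m * P (Suc m) - \<beta> m * P m) - \<gamma> m) \<in> O(\<lambda>m. recip m ^ K)"
    proof (rule expands_bigo)
      fix k assume "k < K"
      thus "((\<Sum>i<K. fps_const (c i) * (A * moebius 1 1 ^ i - B * fps_X ^ i)) - C) $ k = 0"
        by (simp only: fps_sub_nth residual_series_nth sum_shift_coeff_truncate c)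
    qed
    hence "(\<lambda>m. - ((\<alpha> m * P (Suc m) - \<beta> m * P m) - \<gamma> m)) \<in> O(\<lambda>m. recip m ^ K)" by (subst landau_o.big.uminus_in_iff)
    moreover have "eventually (\<lambda>m. - ((\<alpha> m * P (Suc m) - \<beta> m * P m) - \<gamma> m) =
        \<alpha> m * (f (Suc m) - P (Suc m)) - \<beta> m * (f m - P m)) at_top"
      using rec by eventually_elim (simp add: algebra_simps)
    ultimately have "(\<lambda>m. \<alpha> m * (f (Suc m) - P (Suc m)) - \<beta> m * (f m - P m)) \<in> O(\<lambda>m. recip m ^ K)"
      by (rule landau_o.big.in_cong[THEN iffD1, rotated])
    from contraction_bigo[OF expands_tendsto[OF A recip_lim] expands_tendsto[OF B recip_lim] AB this]
    show ?thesis by (simp add: expands_upto_def P_def)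
  qed
  thus ?thesis using c by (intro exI[of _ "Abs_fps c"]) (simp add: expands_def)
qed

text \<open>
  With \<open>A $ 0 = B $ 0\<close> the diagonal of the triangular system vanishes, and with \<open>A $ 1 = B $ 1\<close> the
  next diagonal is \<open>- n\<close>. Hence the equations shifted by one determine every coefficient from the
  first one, which is the limit of \<open>f\<close>, and the residual of the truncated series gains one order.
  That order is what the summation of residuals loses.
\<close>
lemma expands_convergent_recurrence:
  assumes A: "expands recip \<alpha> A" and B: "expands recip \<beta> B"
    and AB: "A $ 0 = 1" "B $ 0 = 1" "A $ 1 = B $ 1"
    and mono: "eventually (\<lambda>m. 0 \<le> \<alpha> m \<and> \<alpha> m \<le> \<beta> m \<and> 1 \<le> \<beta> m) at_top"
    and rec: "eventually (\<lambda>m. \<alpha> m * f (Suc m) = \<beta> m * f m) at_top"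
    and lim: "f \<longlonglongrightarrow> L"
  shows "\<exists>F. expands recip f F \<and> F $ 0 = L \<and> (\<forall>n. (\<Sum>i\<le>n. F $ i * shift_coeff A B i (Suc n)) = 0)"
proof -
  \<comment> \<open>row \<open>0\<close> prescribes the first coefficient; row \<open>n\<close> is equation \<open>n + 1\<close> of the original system\<close>
  define w where "w = (\<lambda>i n. if n = 0 then 1 else shift_coeff A B i (Suc n))"
  have "w n n \<noteq> 0" for n using AB by (simp add: w_def shift_coeff_Suc_diag)
  then obtain c where c: "\<And>n. (\<Sum>i\<le>n. c i * w i n) = (if n = 0 then L else 0)"
    using triangular_system_solvable[of w "\<lambda>n. if n = 0 then L else 0"] by blast
  have c0: "c 0 = L" using c[of 0] by (simp add: w_def)
  have c1: "(\<Sum>i\<le>n. c i * shift_coeff A B i (Suc n)) = 0" for n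
    using c[of n] AB by (cases "n = 0") (simp_all add: w_def shift_coeff_Suc_diag)
  have "expands_upto K recip f (Abs_fps c)" for K
  proof (cases "K = 0")
    case True
    have "f \<in> O(\<lambda>_. 1)" using lim by (intro bigoI_tendsto[where c=L]) auto
    thus ?thesis using True by (simp add: expands_upto_def)
  next
    case False
    define P where "P = (\<lambda>m. \<Sum>i<K. c i * recip m ^ i)"
    have P: "expands recip P (\<Sum>k<K. fps_const (c k) * fps_X ^ k)"
      using expands_truncation[OF recip_lim, where K = K and F = "Abs_fps c"] by (simp add: P_def)
    have "expands recip (\<lambda>m. (\<alpha> m * P (Suc m) - \<beta> m * P m))
       (\<Sum>i<K. fps_const (c i) * (A * moebius 1 1 ^ i - B * fps_X ^ i))"
      unfolding P_def by (intro expands_residual[OF A B])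
    hence "(\<lambda>m. \<alpha> m * P (Suc m) - \<beta> m * P m) \<in> O(\<lambda>m. recip m ^ Suc K)"
    proof (rule expands_bigo)
      fix k assume k: "k < Suc K"
      have "(\<Sum>i<K. c i * shift_coeff A B i k) = 0"
      proof (cases k)
        case 0
        have "c i * shift_coeff A B i 0 = 0" for i
          by (cases "i = 0") (use AB in \<open>auto simp: shift_coeff_diag shift_coeff_below\<close>)
        thus ?thesis unfolding 0 by (intro sum.neutral) blast
      next
        case (Suc n)
        have "(\<Sum>i<K. c i * shift_coeff A B i k) = (\<Sum>i\<le>n. c i * shift_coeff A B i k)"
        proof (intro sum.mono_neutral_right)
          show "\<forall>i\<in>{..<K} - {..n}. c i * shift_coeff A B i k = 0"
          proof
            fix i assume "i \<in> {..<K} - {..n}"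
            hence "i = k \<or> k < i" using Suc by auto
            thus "c i * shift_coeff A B i k = 0" using AB by (auto simp: shift_coeff_diag shift_coeff_below)
          qed
        qed (use k Suc in auto)
        thus ?thesis using c1[of n] Suc by simp
      qed
      thus "(\<Sum>i<K. fps_const (c i) * (A * moebius 1 1 ^ i - B * fps_X ^ i)) $ k = 0"
        by (simp only: residual_series_nth)
    qed
    then obtain D where D: "D > 0"
      "eventually (\<lambda>m. norm (\<alpha> m * P (Suc m) - \<beta> m * P m) \<le> D * norm (recip m ^ Suc K)) at_top"
      by (rule landau_o.bigE)
    have "(\<lambda>m. f m - P m) \<in> O(\<lambda>m. recip m ^ K)"
    proof (rule telescoping_bigo)
      have "P \<longlonglongrightarrow> L" using expands_tendsto[OF P recip_lim] False truncation_nth[where F = "Abs_fps c" and K = K and n = 0]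
        by (simp add: c0)
      thus "(\<lambda>m. f m - P m) \<longlonglongrightarrow> 0" using tendsto_diff[OF lim, of P L] by simp
      show "K > 0" "D \<ge> 0" using False D by auto
      show "eventually (\<lambda>m. \<bar>f m - P m\<bar> \<le> \<bar>f (Suc m) - P (Suc m)\<bar> + D * recip m ^ Suc K) at_top"
        using mono rec D(2)
      proof eventually_elim
        case (elim m)
        define e e' \<rho> where "e = f m - P m" and "e' = f (Suc m) - P (Suc m)"
          and "\<rho> = \<alpha> m * P (Suc m) - \<beta> m * P m"
        \<comment> \<open>solved backwards, from \<open>m + 1\<close> to \<open>m\<close>, the recurrence does not enlarge errors\<close>
        have "\<beta> m * e = \<alpha> m * e' + \<rho>" using elim(2) by (simp add: e_def e'_def \<rho>_def algebra_simps)
        moreover have "\<bar>\<beta> m * e\<bar> = \<beta> m * \<bar>e\<bar>" using elim(1) by (simp add: abs_mult)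
        ultimately have "\<beta> m * \<bar>e\<bar> = \<bar>\<alpha> m * e' + \<rho>\<bar>" by simp
        also have "\<dots> \<le> \<alpha> m * \<bar>e'\<bar> + \<bar>\<rho>\<bar>" using elim(1) abs_triangle_ineq[of "\<alpha> m * e'" \<rho>] by (simp add: abs_mult)
        also have "\<dots> \<le> \<beta> m * \<bar>e'\<bar> + \<beta> m * \<bar>\<rho>\<bar>"
          using elim(1) mult_right_mono[of 1 "\<beta> m" "\<bar>\<rho>\<bar>"] by (intro add_mono mult_right_mono) auto
        finally have "\<beta> m * \<bar>e\<bar> \<le> \<beta> m * (\<bar>e'\<bar> + \<bar>\<rho>\<bar>)" by (simp add: algebra_simps)
        hence "\<bar>e\<bar> \<le> \<bar>e'\<bar> + \<bar>\<rho>\<bar>" using elim(1) by simp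
        moreover have "\<bar>\<rho>\<bar> \<le> D * recip m ^ Suc K" using elim(3) by (simp add: \<rho>_def)
        ultimately show ?case by (simp add: e_def e'_def)
      qed
    qed
    thus ?thesis by (simp add: expands_upto_def P_def)
  qed
  thus ?thesis using c0 c1 by (intro exI[of _ "Abs_fps c"]) (simp add: expands_def)
qed

section \<open>Central binomial coefficients and the excess over half the deck\<close>

definition central :: "nat \<Rightarrow> real" where
  "central m = real ((2 * m) choose m) / 4 ^ m"

lemma central_pos: "central m > 0"
  by (simp add: central_def)

lemma real_choose_step:
  "real (Suc m) * real (Suc (2 * m) choose m) = real (2 * m + 1) * real (2 * m choose m)"
  "real (2 * Suc m choose Suc m) = 2 * real (Suc (2 * m) choose m)"
proof -
  have *: "Suc (2 * m) choose m = Suc (2 * m) choose Suc m"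
    by (subst binomial_symmetric) auto
  have "Suc m * (Suc (2 * m) choose Suc m) = Suc (2 * m) * (2 * m choose m)"
    by (rule Suc_times_binomial)
  hence "real (Suc m) * real (Suc (2 * m) choose Suc m) = real (Suc (2 * m)) * real (2 * m choose m)"
    by (metis of_nat_mult)
  thus "real (Suc m) * real (Suc (2 * m) choose m) = real (2 * m + 1) * real (2 * m choose m)"
    using * by simp
  have "2 * Suc m choose Suc m = (Suc (2 * m) choose m) + (Suc (2 * m) choose Suc m)"
    by simp
  thus "real (2 * Suc m choose Suc m) = 2 * real (Suc (2 * m) choose m)"
    unfolding * by linarith
qed

lemma central_Suc_odd: "central (Suc m) = 2 * (real (Suc (2 * m) choose m) / 2 ^ (2 * m + 2))"
  unfolding central_def real_choose_step(2) by (simp add: power_mult)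

lemma central_Suc: "central (Suc m) * (2 * real m + 2) = central m * (2 * real m + 1)"
proof -
  have "central (Suc m) * (2 * real m + 2) = real (Suc m) * real (Suc (2 * m) choose m) / 4 ^ m"
  proof -
    have "2 ^ (2 * m + 2) = 4 * (4::real) ^ m" by (simp add: power_mult)
    thus ?thesis unfolding central_Suc_odd by (simp add: field_simps)
  qed
  also have "\<dots> = central m * (2 * real m + 1)"
    unfolding real_choose_step(1) by (simp add: central_def)
  finally show ?thesis .
qed

text \<open>
  The increments at \<open>2 m + 1\<close> and at \<open>2 m + 2\<close> both equal \<open>1/2 + central (m + 1) / 2\<close>, because
  \<open>2 m + 1 choose m\<close> is half of \<open>2 m + 2 choose m + 1\<close>.
\<close>
lemma tail_mean_even_odd:
  "tail_mean (2 * m) = real m - 1 / 2 + (2 * real m + 1 / 2) * central m \<and>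
   tail_mean (2 * m + 1) = real m + (2 * real m + 1) * central m"
proof (induction m)
  case 0
  show ?case by (simp add: central_def)
next
  case (Suc m)
  have odd: "tail_mean (2 * Suc k + 1) = tail_mean (2 * Suc k) + 1 / 2 + central (Suc k) / 2" for k
    by (simp add: central_def power_mult power_add)
  have even: "tail_mean (2 * Suc m) = tail_mean (2 * m + 1) + 1 / 2 + real (Suc (2 * m) choose m) / 2 ^ (2 * m + 2)"
    by simp
  have c: "(2 * real m + 1) * central m = (2 * real m + 2) * central (Suc m)"
    using central_Suc[of m] by (simp add: mult.commute)
  have "real (Suc (2 * m) choose m) / 2 ^ (2 * m + 2) = central (Suc m) / 2"
    by (simp add: central_Suc_odd)
  hence "tail_mean (2 * Suc m) = real (Suc m) - 1 / 2 + (2 * real (Suc m) + 1 / 2) * central (Suc m)"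
    using even Suc c by (simp add: algebra_simps)
  thus ?case using odd[of m] by (simp add: algebra_simps)
qed

text \<open>
  The term \<open>n / 2\<^sup>n\<close> is a particular solution that accounts for \<open>1 / 2\<^sup>n\<close> in the recurrence of the
  expected score. It is removed because it has expansion \<open>0\<close>.
\<close>
definition excess :: "nat \<Rightarrow> real" where
  "excess n = expected_correct n - real n / 2 + 1 / 2 - real n / 2 ^ n"

lemma excess_Suc: "excess (Suc n) = (excess n + (tail_mean n - real n / 2 + 1 / 2)) / 2"
  by (simp add: excess_def expected_correct_Suc field_simps)

lemma tail_mean_even: "tail_mean (2 * m) = real m - 1 / 2 + (2 * real m + 1 / 2) * central m"
  and tail_mean_odd: "tail_mean (Suc (2 * m)) = real m + (2 * real m + 1) * central m"
  using tail_mean_even_odd[of m] by (auto simp del: tail_mean.simps)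

lemma excess_odd: "excess (Suc (2 * m)) = (excess (2 * m) + (2 * real m + 1 / 2) * central m) / 2"
  unfolding excess_Suc tail_mean_even by simp

lemma excess_even: "excess (2 * Suc m) = excess (2 * m) / 4 + (3 / 2 * real m + 5 / 8) * central m"
proof -
  have "excess (2 * Suc m) = excess (Suc (Suc (2 * m)))" by simp
  also have "\<dots> = (excess (Suc (2 * m)) + (tail_mean (Suc (2 * m)) - real (Suc (2 * m)) / 2 + 1 / 2)) / 2"
    by (rule excess_Suc)
  also have "\<dots> = excess (2 * m) / 4 + (3 / 2 * real m + 5 / 8) * central m"
    unfolding excess_odd tail_mean_odd by (simp add: field_simps)
  finally show ?thesis .
qed

text \<open>
  Dividing by \<open>m\<close> times the central binomial probability turns the recurrence of the excess along
  the even numbers into one with rational coefficients.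
\<close>
definition excess_ratio :: "nat \<Rightarrow> real" where
  "excess_ratio m = excess (2 * m) / (real m * central m)"

lemma excess_ratio_rec:
  assumes "m > 0"
  shows "(1 + 1 / 2 * recip m) * excess_ratio (Suc m) = 1 / 4 * excess_ratio m + (3 / 2 + 5 / 8 * recip m)"
proof -
  have c: "real (Suc m) * central (Suc m) = (real m + 1 / 2) * central m"
    using central_Suc[of m] by (simp add: algebra_simps)
  have "excess_ratio (Suc m) = excess (2 * Suc m) / ((real m + 1 / 2) * central m)"
    unfolding excess_ratio_def c ..
  also have "\<dots> = (excess (2 * m) / 4 + (3 / 2 * real m + 5 / 8) * central m) / ((real m + 1 / 2) * central m)"
    by (simp only: excess_even)
  finally have "(real m + 1 / 2) * excess_ratio (Suc m) = (excess (2 * m) / 4 + (3 / 2 * real m + 5 / 8) * central m) / central m"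
    by simp
  also have "\<dots> = excess (2 * m) / central m / 4 + (3 / 2 * real m + 5 / 8)"
    using central_pos[of m] by (simp add: add_divide_distrib)
  finally have 1: "(real m + 1 / 2) * excess_ratio (Suc m) = excess (2 * m) / central m / 4 + (3 / 2 * real m + 5 / 8)" .
  have "(1 + 1 / 2 * (1 / t)) * r = 1 / 4 * (z / t) + (3 / 2 + 5 / 8 * (1 / t))"
    if "(t + 1 / 2) * r = z / 4 + (3 / 2 * t + 5 / 8)" "t > 0" for t r z :: real
    using that by (simp add: field_simps)
  from this[OF 1] assms show ?thesis by (simp add: excess_ratio_def mult.commute)
qed

text \<open>
  The successive quotients of this square are rational functions of \<open>m\<close>, whereas those of
  \<open>sqrt m * central m\<close> involve square roots.
\<close>
definition central_sq :: "nat \<Rightarrow> real" where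
  "central_sq m = pi * real m * central m ^ 2"

lemma central_sq_rec:
  assumes "m > 0"
  shows "(1 + recip m) * central_sq (Suc m) = (1 + recip m + 1 / 4 * recip m ^ 2) * central_sq m"
proof -
  have c: "central (Suc m) = (real m + 1 / 2) * central m / real (Suc m)"
    using central_Suc[of m] by (simp add: field_simps)
  have "(1 + recip m) * central_sq (Suc m) = pi * ((real m + 1) / real m) * real (Suc m) * ((real m + 1 / 2) * central m / real (Suc m)) ^ 2"
    using assms unfolding central_sq_def c by (simp add: field_simps)
  also have "\<dots> = pi * (real m + 1 / 2) ^ 2 * central m ^ 2 / real m"
  proof -
    have "pi * (s / t) * s * (u * c / s) ^ 2 = pi * u ^ 2 * c ^ 2 / t" if "s \<noteq> 0" for s t u c :: real
      using that by (simp add: power2_eq_square)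
    note * = this
    have "real m + 1 = real (Suc m)" by simp
    thus ?thesis by (simp only:) (rule *, simp)
  qed
  also have "\<dots> = (1 + recip m + 1 / 4 * recip m ^ 2) * central_sq m"
    using assms by (simp add: central_sq_def power2_eq_square field_simps)
  finally show ?thesis .
qed

text \<open>
  By the recurrence of \<open>central\<close>, the quantity \<open>(2 n + 1) * central n ^ 2\<close> is divided by the next factor
  of Wallis' product whenever \<open>n\<close> grows by one.
\<close>
lemma wallis_central: "(\<Prod>k=1..n. (4 * real k ^ 2) / (4 * real k ^ 2 - 1)) * ((2 * real n + 1) * central n ^ 2) = 1"
proof (induction n)
  case 0
  show ?case by (simp add: central_def)
next
  case (Suc n)
  have c: "central (Suc n) = (2 * real n + 1) * central n / (2 * real n + 2)"
    using central_Suc[of n] by (simp add: field_simps)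
  have e: "4 * real (Suc n) ^ 2 / (4 * real (Suc n) ^ 2 - 1) * ((2 * real (Suc n) + 1) * central (Suc n) ^ 2) = (2 * real n + 1) * central n ^ 2"
  proof -
    have 1: "4 * real (Suc n) ^ 2 = (2 * real n + 2) ^ 2"
      "(2 * real n + 2) ^ 2 - 1 = (2 * real n + 1) * (2 * real n + 3)"
      "2 * real (Suc n) + 1 = 2 * real n + 3"
      by (simp_all add: power2_eq_square algebra_simps)
    have "b ^ 2 / (a * d) * (d * (a * c / b) ^ 2) = a * c ^ 2"
      if "a \<noteq> 0" "b \<noteq> 0" "d \<noteq> 0" for a b c d :: real
      using that by (simp add: power2_eq_square)
    from this[of "2 * real n + 1" "2 * real n + 2" "2 * real n + 3" "central n"]
    show ?thesis unfolding 1 c by simp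
  qed
  define g where "g = (\<lambda>k::nat. 4 * real k ^ 2 / (4 * real k ^ 2 - 1))"
  have "(\<Prod>k=1..Suc n. g k) = (\<Prod>k=1..n. g k) * g (Suc n)" by simp
  thus ?case using Suc e unfolding g_def by (simp only: mult.assoc)
qed

lemma central_sq_lim: "central_sq \<longlonglongrightarrow> 1"
proof -
  define W where "W = (\<lambda>n. \<Prod>k=1..n. (4 * real k ^ 2) / (4 * real k ^ 2 - 1))"
  have W: "W \<longlonglongrightarrow> pi / 2" unfolding W_def using wallis by simp
  have eq: "central_sq m = pi * inverse (W m) * (real m / (2 * real m + 1))" for m
  proof -
    have 1: "W m * ((2 * real m + 1) * central m ^ 2) = 1" unfolding W_def by (rule wallis_central)
    have "c = inverse w / k" if "w * (k * c) = 1" for w k c :: real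
      using that by (cases "w = 0"; cases "k = 0") (auto simp: field_simps)
    from this[OF 1] have "central m ^ 2 = inverse (W m) / (2 * real m + 1)" .
    thus ?thesis by (simp add: central_sq_def)
  qed
  have "(\<lambda>m. pi * inverse (W m) * (real m / (2 * real m + 1))) \<longlonglongrightarrow> pi * inverse (pi / 2) * (1 / 2)"
  proof (intro tendsto_mult tendsto_const tendsto_inverse W)
    show "(\<lambda>m. real m / (2 * real m + 1)) \<longlonglongrightarrow> 1 / 2" by real_asymp
  qed simp
  thus ?thesis unfolding eq[abs_def] by simp
qed

lemma excess_ratio_expands:
  "\<exists>F. expands recip excess_ratio F \<and>
     (\<forall>n. (\<Sum>i\<le>n. F $ i * shift_coeff (1 + fps_const (1/2) * fps_X) (fps_const (1/4)) i n)
        = (fps_const (3/2) + fps_const (5/8) * fps_X) $ n)"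
proof (rule expands_contracting_recurrence)
  show "expands recip (\<lambda>m. 1 + 1 / 2 * recip m) (1 + fps_const (1/2) * fps_X)"
    by (intro expands_add expands_one expands_cmult expands_id recip_lim)
  show "expands recip (\<lambda>m. 3 / 2 + 5 / 8 * recip m) (fps_const (3/2) + fps_const (5/8) * fps_X)"
    by (intro expands_add expands_const expands_cmult expands_id recip_lim)
  show "expands recip (\<lambda>m. 1 / 4) (fps_const (1/4))" by (rule expands_const)
  show "eventually (\<lambda>m. (1 + 1 / 2 * recip m) * excess_ratio (Suc m) = 1 / 4 * excess_ratio m + (3 / 2 + 5 / 8 * recip m)) at_top"
    using eventually_gt_at_top[of 0] by eventually_elim (rule excess_ratio_rec)
qed simp

lemma central_sq_expands:
  "\<exists>F. expands recip central_sq F \<and> F $ 0 = 1 \<and>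
     (\<forall>n. (\<Sum>i\<le>n. F $ i * shift_coeff (1 + fps_const 1 * fps_X) (1 + fps_X + fps_const (1/4) * fps_X ^ 2) i (Suc n)) = 0)"
proof (rule expands_convergent_recurrence)
  show "expands recip (\<lambda>m. 1 + 1 * recip m) (1 + fps_const 1 * fps_X)"
    by (intro expands_add expands_one expands_cmult expands_id recip_lim)
  show "expands recip (\<lambda>m. 1 + recip m + 1 / 4 * recip m ^ 2) (1 + fps_X + fps_const (1/4) * fps_X ^ 2)"
    by (intro expands_add expands_one expands_cmult expands_id expands_power recip_lim)
  show "eventually (\<lambda>m. (1 + 1 * recip m) * central_sq (Suc m) = (1 + recip m + 1 / 4 * recip m ^ 2) * central_sq m) at_top"
    using eventually_gt_at_top[of 0] by eventually_elim (use central_sq_rec in simp)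
qed (auto simp: fps_power_nth power2_eq_square central_sq_lim)

section \<open>Coefficients and the expansion of the expected score\<close>

text \<open>
  The coefficients of powers of \<open>moebius a b\<close>, in a form that the simplifier can evaluate.
\<close>
fun moebius_coeff :: "real \<Rightarrow> real \<Rightarrow> nat \<Rightarrow> nat \<Rightarrow> real" where
  "moebius_coeff a b 0 n = (if n = 0 then 1 else 0)"
| "moebius_coeff a b (Suc i) 0 = 0"
| "moebius_coeff a b (Suc i) (Suc n) = a * moebius_coeff a b i n - b * moebius_coeff a b (Suc i) n"

lemma moebius_power_nth: "(moebius a b ^ i) $ n = moebius_coeff a b i n"
  by (induction a b i n rule: moebius_coeff.induct) (simp_all add: moebius_power_Suc_nth del: power_Suc)

lemma shift_coeff_eval:
  "shift_coeff (1 + fps_const a * fps_X) B i n =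
     moebius_coeff 1 1 i n + (if n = 0 then 0 else a * moebius_coeff 1 1 i (n - 1)) - (if n < i then 0 else B $ (n - i))"
  by (simp add: shift_coeff_def fps_X_power_mult_right_nth distrib_right mult.assoc moebius_power_nth del: power_Suc)

lemma compose_moebius_nth: "(F oo moebius a b) $ n = (\<Sum>i=0..n. F $ i * moebius_coeff a b i n)"
  by (simp add: fps_compose_nth moebius_power_nth)

text \<open>
  The triangular system is solved one unknown at a time: equation \<open>n\<close> is linear in \<open>F $ n\<close> once the
  earlier coefficients are inserted. Six coefficients are needed, since the leading one
  gives the term \<open>sqrt (2 n / \<pi>)\<close> and the next five become \<open>c\<^sub>0, \<dots>, c\<^sub>4\<close>.
\<close>
lemma excess_coeffs:
  assumes "\<And>n. (\<Sum>i\<le>n. F $ i * shift_coeff (1 + fps_const (1/2) * fps_X) (fps_const (1/4)) i n)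
        = (fps_const (3/2) + fps_const (5/8) * fps_X) $ n"
  shows "F $ 0 = 2" "F $ 1 = -1/2" "F $ 2 = -1/3" "F $ 3 = -1/3" "F $ 4 = -5/9" "F $ 5 = -37/27"
proof -
  note eval = shift_coeff_eval numeral_eq_Suc
  show 0: "F $ 0 = 2" using assms[of 0] by (simp add: eval)
  show 1: "F $ 1 = -1/2" using assms[of 1] 0 by (simp add: eval)
  show 2: "F $ 2 = -1/3" using assms[of 2] 0 1 by (simp add: eval)
  show 3: "F $ 3 = -1/3" using assms[of 3] 0 1 2 by (simp add: eval)
  show 4: "F $ 4 = -5/9" using assms[of 4] 0 1 2 3 by (simp add: eval)
  show 5: "F $ 5 = -37/27" using assms[of 5] 0 1 2 3 4 by (simp add: eval)
qed

lemma central_sq_coeffs: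
  assumes "\<And>n. (\<Sum>i\<le>n. F $ i * shift_coeff (1 + fps_const 1 * fps_X) (1 + fps_X + fps_const (1/4) * fps_X ^ 2) i (Suc n)) = 0"
    and 0: "F $ 0 = 1"
  shows "F $ 1 = -1/4" "F $ 2 = 1/32" "F $ 3 = 1/128" "F $ 4 = -5/2048" "F $ 5 = -23/8192"
proof -
  have B: "(1 + fps_X + fps_const (1/4) * fps_X ^ 2) $ n = (if n = 0 then 1 else if n = 1 then 1 else if n = 2 then 1/4 else (0::real))" for n
    by (simp add: fps_X_power_nth)
  note eval = shift_coeff_eval[of 1, simplified fps_const_1_eq_1 mult_1] B numeral_eq_Suc
  show 1: "F $ 1 = -1/4" using assms(1)[of 1] 0 by (simp add: eval)
  show 2: "F $ 2 = 1/32" using assms(1)[of 2] 0 1 by (simp add: eval)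
  show 3: "F $ 3 = 1/128" using assms(1)[of 3] 0 1 2 by (simp add: eval)
  show 4: "F $ 4 = -5/2048" using assms(1)[of 4] 0 1 2 3 by (simp add: eval)
  show 5: "F $ 5 = -23/8192" using assms(1)[of 5] 0 1 2 3 4 by (simp add: eval)
qed

lemma fps_sqrt_coeffs:
  fixes S :: "real fps"
  assumes "S $ 0 = 1"
  shows "S $ 1 = (S * S) $ 1 / 2"
    "S $ 2 = ((S * S) $ 2 - (S $ 1) ^ 2) / 2"
    "S $ 3 = ((S * S) $ 3 - 2 * S $ 1 * S $ 2) / 2"
    "S $ 4 = ((S * S) $ 4 - 2 * S $ 1 * S $ 3 - (S $ 2) ^ 2) / 2"
    "S $ 5 = ((S * S) $ 5 - 2 * S $ 1 * S $ 4 - 2 * S $ 2 * S $ 3) / 2"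
  using assms by (simp_all add: fps_mult_nth numeral_eq_Suc algebra_simps)

lemma fps_sqrt_exists:
  fixes R :: "real fps"
  assumes "R $ 0 = 1"
  obtains S where "S * S = R" "S $ 0 = 1"
proof
  show "fps_radical (\<lambda>_ _. 1) (Suc 1) R * fps_radical (\<lambda>_ _. 1) (Suc 1) R = R"
    using power_radical[of R "\<lambda>_ _. 1" 1] assms by (simp add: power2_eq_square)
qed simp

text \<open>
  The normalization makes the limit \<open>1\<close>.
\<close>
definition normalized_gain :: "nat \<Rightarrow> real" where
  "normalized_gain n = (expected_correct n - real n / 2 + 1 / 2) / sqrt (2 * real n / pi)"

lemma exponentially_small_bigo: "(\<lambda>n. real n / 2 ^ n / sqrt (2 * real n / pi)) \<in> O(\<lambda>n. recip n ^ K)"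
proof (rule bigoI_tendsto[where c = 0])
  show "(\<lambda>n. real n / 2 ^ n / sqrt (2 * real n / pi) / recip n ^ K) \<longlonglongrightarrow> 0"
    unfolding power_one_over by real_asymp
  show "\<forall>\<^sub>F n in sequentially. recip n ^ K \<noteq> 0"
    using eventually_gt_at_top[of 0] by eventually_elim simp
qed

lemma expands_exponentially_small:
  assumes "filterlim g at_top at_top"
  shows "expands (\<lambda>m. recip (g m)) (\<lambda>m. real (g m) / 2 ^ g m / sqrt (2 * real (g m) / pi)) 0"
  unfolding expands_def expands_upto_def
  using landau_o.big.compose[OF exponentially_small_bigo assms] by simp

lemma sqrt_central_sq:
  assumes "m > 0"
  shows "central m = sqrt (central_sq m / (pi * real m))"
  using central_pos[of m] assms by (simp add: central_sq_def)

lemma normalized_gain_even: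
  assumes "m > 0"
  shows "1 / 2 * (excess_ratio m * sqrt (central_sq m)) + real (2 * m) / 2 ^ (2 * m) / sqrt (2 * real (2 * m) / pi) = normalized_gain (2 * m)"
proof -
  have "expected_correct (2 * m) - real (2 * m) / 2 + 1 / 2 = excess (2 * m) + real (2 * m) / 2 ^ (2 * m)"
    by (simp add: excess_def)
  moreover have "excess (2 * m) / sqrt (2 * real (2 * m) / pi) = 1 / 2 * (excess_ratio m * sqrt (central_sq m))"
  proof -
    have "excess (2 * m) = real m * excess_ratio m * central m"
      using assms central_pos[of m] by (simp add: excess_ratio_def)
    also have "real m * excess_ratio m * central m / sqrt (2 * real (2 * m) / pi) =
        excess_ratio m * sqrt (central_sq m) * (real m / (sqrt (pi * real m) * sqrt (4 * real m / pi)))"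
      using assms by (subst sqrt_central_sq) (simp_all add: real_sqrt_divide)
    also have "sqrt (pi * real m) * sqrt (4 * real m / pi) = sqrt ((2 * real m)\<^sup>2)"
      unfolding real_sqrt_mult[symmetric] by (simp add: power2_eq_square)
    also have "\<dots> = 2 * real m" by (simp only: real_sqrt_abs)
    finally show ?thesis using assms by simp
  qed
  ultimately show ?thesis by (simp add: normalized_gain_def add_divide_distrib)
qed

lemma normalized_gain_odd:
  assumes "m > 0"
  shows "1 / 4 * ((2 + 1 / 2 * recip m + excess_ratio m) * sqrt (central_sq m * inverse (1 + 1 / 2 * recip m)))
     + real (2 * m + 1) / 2 ^ (2 * m + 1) / sqrt (2 * real (2 * m + 1) / pi) = normalized_gain (2 * m + 1)"
proof -
  have "expected_correct (2 * m + 1) - real (2 * m + 1) / 2 + 1 / 2 = excess (Suc (2 * m)) + real (2 * m + 1) / 2 ^ (2 * m + 1)"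
    by (simp add: excess_def)
  moreover have "excess (Suc (2 * m)) / sqrt (2 * real (2 * m + 1) / pi) =
     1 / 4 * ((2 + 1 / 2 * recip m + excess_ratio m) * sqrt (central_sq m * inverse (1 + 1 / 2 * recip m)))"
  proof -
    have "excess (2 * m) = real m * excess_ratio m * central m"
      using assms central_pos[of m] by (simp add: excess_ratio_def)
    hence "excess (Suc (2 * m)) = (2 + 1 / 2 * recip m + excess_ratio m) * real m / 2 * central m"
      unfolding excess_odd using assms by (simp add: field_simps)
    moreover have "real m * central m / sqrt (2 * real (2 * m + 1) / pi) = sqrt (central_sq m * inverse (1 + 1 / 2 * recip m)) / 2"
    proof -
      have "(real m * central m)\<^sup>2 / (2 * real (2 * m + 1) / pi) = central_sq m * inverse (1 + 1 / 2 * recip m) / 4"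
        using assms by (simp add: central_sq_def power2_eq_square field_simps)
      hence "sqrt ((real m * central m)\<^sup>2 / (2 * real (2 * m + 1) / pi)) = sqrt (central_sq m * inverse (1 + 1 / 2 * recip m) / 4)"
        by simp
      moreover have "sqrt (x\<^sup>2 / y) = x / sqrt y" if "x \<ge> 0" for x y :: real
        using that by (subst real_sqrt_divide) simp
      moreover have "sqrt (z / 4) = sqrt z / 2" for z by (simp add: real_sqrt_divide)
      ultimately show ?thesis using central_pos[of m] by (simp only: mult_nonneg_nonneg of_nat_0_le_iff less_imp_le)
    qed
    moreover have "e / y = 1 / 4 * (a * z)" if "e = a * t / 2 * c" "t * c / y = z / 2" for a c e t y z :: real
    proof -
      have "e / y = a / 2 * (t * c / y)" unfolding that(1) by simp
      thus ?thesis using that(2) by simp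
    qed
    ultimately show ?thesis by blast
  qed
  ultimately show ?thesis by (simp add: normalized_gain_def add_divide_distrib)
qed

lemma filterlim_double: "filterlim (\<lambda>m. 2 * m + s) at_top (at_top :: nat filter)"
  by (rule filterlim_at_top_mono[OF filterlim_ident]) simp

lemma double_recip_lim: "(\<lambda>m. recip (2 * m + s)) \<longlonglongrightarrow> 0"
  using filterlim_compose[OF recip_lim filterlim_double] .

lemma normalized_gain_even_expands:
  "\<exists>F. expands (\<lambda>m. recip (2 * m)) (\<lambda>m. normalized_gain (2 * m)) F \<and> F $ 0 = 1 \<and>
     F $ 1 = -3/4 \<and> F $ 2 = -49/96 \<and> F $ 3 = -439/384 \<and> F $ 4 = -76709/18432 \<and> F $ 5 = -4628519/221184"
proof -
  obtain F where F: "expands recip excess_ratio F"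
     "\<And>n. (\<Sum>i\<le>n. F $ i * shift_coeff (1 + fps_const (1/2) * fps_X) (fps_const (1/4)) i n)
        = (fps_const (3/2) + fps_const (5/8) * fps_X) $ n"
    using excess_ratio_expands by blast
  note Fc = excess_coeffs[OF F(2)]
  obtain R where R: "expands recip central_sq R" "R $ 0 = 1"
     "\<And>n. (\<Sum>i\<le>n. R $ i * shift_coeff (1 + fps_const 1 * fps_X) (1 + fps_X + fps_const (1/4) * fps_X ^ 2) i (Suc n)) = 0"
    using central_sq_expands by blast
  note Rc = central_sq_coeffs[OF R(3,2)]
  obtain S where S: "S * S = R" "S $ 0 = 1" using fps_sqrt_exists[OF R(2)] by blast
  note sq = fps_sqrt_coeffs[OF S(2), unfolded S(1) Rc]
  have S1: "S $ 1 = -1/8" using sq(1) by (simp add: power2_eq_square)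
  have S2: "S $ 2 = 1/128" using sq(2) S1 by (simp add: power2_eq_square)
  have S3: "S $ 3 = 5/1024" using sq(3) S1 S2 by (simp add: power2_eq_square)
  have S4: "S $ 4 = -21/32768" using sq(4) S1 S2 S3 by (simp add: power2_eq_square)
  have S5: "S $ 5 = -399/262144" using sq(5) S1 S2 S3 S4 by (simp add: power2_eq_square)
  note coeffs = Fc S(2) S1 S2 S3 S4 S5
  define G where "G = fps_const (1/2) * (F * S)"
  define H where "H = G oo moebius 2 0"
  have "expands recip (\<lambda>m. sqrt (central_sq m)) S"
    by (rule expands_sqrt[OF recip_lim]) (use R S in auto)
  hence G: "expands recip (\<lambda>m. 1 / 2 * (excess_ratio m * sqrt (central_sq m))) G"
    unfolding G_def by (intro expands_cmult expands_mult[OF recip_lim] F)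
  have lim: "(\<lambda>m. recip (2 * m)) \<longlonglongrightarrow> 0" using double_recip_lim[of 0] by simp
  have "expands (\<lambda>m. recip (2 * m)) recip (moebius 2 0)"
    by (rule expands_eventually_cong[OF expands_moebius[OF lim]]) simp
  hence "expands (\<lambda>m. recip (2 * m)) (\<lambda>m. 1 / 2 * (excess_ratio m * sqrt (central_sq m))) H"
    unfolding H_def by (intro expands_compose[OF lim G]) auto
  from expands_add[OF this expands_exponentially_small[OF filterlim_double[of 0], unfolded add_0_right]]
  have "expands (\<lambda>m. recip (2 * m)) (\<lambda>m. normalized_gain (2 * m)) (H + 0)"
  proof (rule expands_eventually_cong)
    show "\<forall>\<^sub>F m in sequentially. 1 / 2 * (excess_ratio m * sqrt (central_sq m))
       + real (2 * m) / 2 ^ (2 * m) / sqrt (2 * real (2 * m) / pi) = normalized_gain (2 * m)"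
      using eventually_gt_at_top[of 0] by eventually_elim (rule normalized_gain_even)
  qed
  hence "expands (\<lambda>m. recip (2 * m)) (\<lambda>m. normalized_gain (2 * m)) H" by simp
  moreover have "H $ 0 = 1" "H $ 1 = -3/4" "H $ 2 = -49/96" "H $ 3 = -439/384" "H $ 4 = -76709/18432" "H $ 5 = -4628519/221184"
    unfolding H_def G_def compose_moebius_nth
    by (simp_all add: fps_mult_nth numeral_eq_Suc
          coeffs[unfolded numeral_eq_Suc pred_numeral_simps BitM.simps One_nat_def])
  ultimately show ?thesis by blast
qed

text \<open>
  The factor \<open>1 + 1/(2 m)\<close> comes from \<open>sqrt (2 m + 1)\<close> in the normalization; it is put under the
  same square root as \<open>central_sq\<close>.
\<close>
lemma normalized_gain_odd_expands:
  "\<exists>F. expands (\<lambda>m. recip (2 * m + 1)) (\<lambda>m. normalized_gain (2 * m + 1)) F \<and> F $ 0 = 1 \<and>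
     F $ 1 = -3/4 \<and> F $ 2 = -53/96 \<and> F $ 3 = -443/384 \<and> F $ 4 = -75949/18432 \<and> F $ 5 = -4621519/221184"
proof -
  obtain F where F: "expands recip excess_ratio F"
     "\<And>n. (\<Sum>i\<le>n. F $ i * shift_coeff (1 + fps_const (1/2) * fps_X) (fps_const (1/4)) i n)
        = (fps_const (3/2) + fps_const (5/8) * fps_X) $ n"
    using excess_ratio_expands by blast
  note Fc = excess_coeffs[OF F(2)]
  obtain R where R: "expands recip central_sq R" "R $ 0 = 1"
     "\<And>n. (\<Sum>i\<le>n. R $ i * shift_coeff (1 + fps_const 1 * fps_X) (1 + fps_X + fps_const (1/4) * fps_X ^ 2) i (Suc n)) = 0"
    using central_sq_expands by blast
  note Rc = central_sq_coeffs[OF R(3,2)]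
  define I where "I = inverse (1 + fps_const (1/2) * fps_X :: real fps)"
  define Q where "Q = R * I"
  have Q0: "Q $ 0 = 1" by (simp add: Q_def I_def R)
  have "Q * (1 + fps_const (1/2) * fps_X) = R"
    by (simp add: Q_def I_def mult.assoc inverse_mult_eq_1)
  hence Qeq: "Q $ n + (if n = 0 then 0 else 1/2 * Q $ (n - 1)) = R $ n" for n
    by (auto simp: distrib_left mult.assoc[symmetric] mult.commute[of Q])
  have Q1: "Q $ 1 = -3/4" using Qeq[of 1] Q0 Rc by simp
  have Q2: "Q $ 2 = 13/32" using Qeq[of 2] Q1 Rc by simp
  have Q3: "Q $ 3 = -25/128" using Qeq[of 3] Q2 Rc by simp
  have Q4: "Q $ 4 = 195/2048" using Qeq[of 4] Q3 Rc by simp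
  have Q5: "Q $ 5 = -413/8192" using Qeq[of 5] Q4 Rc by simp
  obtain S where S: "S * S = Q" "S $ 0 = 1" using fps_sqrt_exists[OF Q0] by blast
  note sq = fps_sqrt_coeffs[OF S(2), unfolded S(1) Q1 Q2 Q3 Q4 Q5]
  have S1: "S $ 1 = -3/8" using sq(1) by (simp add: power2_eq_square)
  have S2: "S $ 2 = 17/128" using sq(2) S1 by (simp add: power2_eq_square)
  have S3: "S $ 3 = -49/1024" using sq(3) S1 S2 by (simp add: power2_eq_square)
  have S4: "S $ 4 = 683/32768" using sq(4) S1 S2 S3 by (simp add: power2_eq_square)
  have S5: "S $ 5 = -2893/262144" using sq(5) S1 S2 S3 S4 by (simp add: power2_eq_square)
  note coeffs = Fc S(2) S1 S2 S3 S4 S5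
  define G where "G = fps_const (1/4) * ((fps_const 2 + fps_const (1/2) * fps_X + F) * S)"
  define H where "H = G oo moebius 2 (-1)"
  have "expands recip (\<lambda>m. central_sq m * inverse (1 + 1 / 2 * recip m)) Q"
    unfolding Q_def I_def
    by (intro expands_mult[OF recip_lim] R expands_inverse[OF recip_lim] expands_add
          expands_one expands_cmult expands_id recip_lim) simp
  hence "expands recip (\<lambda>m. sqrt (central_sq m * inverse (1 + 1 / 2 * recip m))) S"
    by (intro expands_sqrt[OF recip_lim]) (use S in auto)
  hence G: "expands recip (\<lambda>m. 1 / 4 * ((2 + 1 / 2 * recip m + excess_ratio m) * sqrt (central_sq m * inverse (1 + 1 / 2 * recip m)))) G"
    unfolding G_def by (intro expands_cmult expands_mult[OF recip_lim] expands_add F expands_const expands_id recip_lim)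
  have lim: "(\<lambda>m. recip (2 * m + 1)) \<longlonglongrightarrow> 0" using double_recip_lim[of 1] .
  have "expands (\<lambda>m. recip (2 * m + 1)) recip (moebius 2 (-1))"
  proof (rule expands_eventually_cong[OF expands_moebius[OF lim]])
    show "\<forall>\<^sub>F m in sequentially. 2 * recip (2 * m + 1) / (1 + - 1 * recip (2 * m + 1)) = recip m"
      using eventually_gt_at_top[of 0]
    proof eventually_elim
      case (elim m)
      have "2 * (1 / (t + 1)) / (1 + - 1 * (1 / (t + 1))) = 2 / t" if "t > 0" for t :: real
      proof -
        have "1 + - 1 * (1 / (t + 1)) = t / (t + 1)" using that by (simp add: field_simps)
        moreover have "2 * (1 / s) / (t / s) = 2 / t" if "s \<noteq> 0" for s :: real using that by simp
        ultimately show ?thesis using that by (simp only:)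
      qed
      from this[of "2 * real m"] elim show ?case by (simp add: add.commute)
    qed
  qed
  hence "expands (\<lambda>m. recip (2 * m + 1)) (\<lambda>m. 1 / 4 * ((2 + 1 / 2 * recip m + excess_ratio m) * sqrt (central_sq m * inverse (1 + 1 / 2 * recip m)))) H"
    unfolding H_def by (intro expands_compose[OF lim G]) auto
  from expands_add[OF this expands_exponentially_small[OF filterlim_double[of 1]]]
  have "expands (\<lambda>m. recip (2 * m + 1)) (\<lambda>m. normalized_gain (2 * m + 1)) (H + 0)"
  proof (rule expands_eventually_cong)
    show "\<forall>\<^sub>F m in sequentially. 1 / 4 * ((2 + 1 / 2 * recip m + excess_ratio m) * sqrt (central_sq m * inverse (1 + 1 / 2 * recip m)))
     + real (2 * m + 1) / 2 ^ (2 * m + 1) / sqrt (2 * real (2 * m + 1) / pi) = normalized_gain (2 * m + 1)"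
      using eventually_gt_at_top[of 0] by eventually_elim (rule normalized_gain_odd)
  qed
  hence "expands (\<lambda>m. recip (2 * m + 1)) (\<lambda>m. normalized_gain (2 * m + 1)) H" by simp
  moreover have "H $ 0 = 1" "H $ 1 = -3/4" "H $ 2 = -53/96" "H $ 3 = -443/384" "H $ 4 = -75949/18432" "H $ 5 = -4621519/221184"
    unfolding H_def G_def compose_moebius_nth
    by (simp_all add: fps_mult_nth numeral_eq_Suc
          coeffs[unfolded numeral_eq_Suc pred_numeral_simps BitM.simps One_nat_def])
  ultimately show ?thesis by blast
qed

text \<open>
  The first coefficient of the normalized gain yields \<open>sqrt (2 n / \<pi>)\<close>. Because
  \<open>sqrt (2 n / \<pi>) = n * sqrt (2 / (\<pi> n))\<close>, the coefficients shift by one place and change sign, and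
  \<open>K + 2\<close> terms are needed for a remainder of order \<open>K + 1\<close>.
\<close>
lemma expected_correct_expansion:
  assumes exp: "expands (\<lambda>m. recip (2 * m + s)) (\<lambda>m. normalized_gain (2 * m + s)) F" and F0: "F $ 0 = 1"
    and A: "\<And>n. n \<in> A \<Longrightarrow> \<exists>m. n = 2 * m + s"
    and c: "\<And>j. c j = - F $ Suc j"
  shows "\<exists>r \<in> O[at_top \<sqinter> principal A](\<lambda>n. 1 / real n ^ (K + 1)).
        \<forall>\<^sub>F n in at_top \<sqinter> principal A.
          expected_correct n =
            real n / 2 + sqrt (2 * real n / pi) - 1/2
              - sqrt (2 / (pi * real n)) * ((\<Sum>j=0..K. c j / real n ^ j) + r n)"
proof -
  define e where "e = (\<lambda>n. normalized_gain n - (\<Sum>k<K+2. F $ k * recip n ^ k))"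
  define r where "r = (\<lambda>n. - real n * e n)"
  have "(\<lambda>m. e (2 * m + s)) \<in> O(\<lambda>m. recip (2 * m + s) ^ (K + 2))"
    using exp unfolding expands_def expands_upto_def e_def by blast
  then obtain C where C: "C > 0"
    "eventually (\<lambda>m. norm (e (2 * m + s)) \<le> C * norm (recip (2 * m + s) ^ (K + 2))) at_top"
    by (rule landau_o.bigE)
  then obtain M where M: "\<And>m. m \<ge> M \<Longrightarrow> \<bar>e (2 * m + s)\<bar> \<le> C * recip (2 * m + s) ^ (K + 2)"
    by (auto simp: eventually_at_top_linorder)
  have ev: "eventually (\<lambda>n. n > 0 \<and> n \<ge> 2 * M + s \<and> n \<in> A) (at_top \<sqinter> principal A)"
    unfolding eventually_inf_principal
    using eventually_gt_at_top[of 0] eventually_ge_at_top[of "2 * M + s"] by eventually_elim simp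
  have "r \<in> O[at_top \<sqinter> principal A](\<lambda>n. 1 / real n ^ (K + 1))"
  proof (rule bigoI)
    show "\<forall>\<^sub>F n in at_top \<sqinter> principal A. norm (r n) \<le> C * norm (1 / real n ^ (K + 1))"
      using ev
    proof eventually_elim
      case (elim n)
      then obtain m where m: "n = 2 * m + s" using A by blast
      with elim have "m \<ge> M" by simp
      from M[OF this] have "\<bar>e n\<bar> \<le> C * recip n ^ (K + 2)" by (simp add: m)
      hence "real n * \<bar>e n\<bar> \<le> real n * (C * recip n ^ (K + 2))" by (intro mult_left_mono) auto
      also have "\<dots> = C * recip n ^ (K + 1)" using elim by simp
      finally show ?case by (simp add: r_def abs_mult power_one_over)
    qed
  qed
  moreover have "\<forall>\<^sub>F n in at_top \<sqinter> principal A.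
          expected_correct n =
            real n / 2 + sqrt (2 * real n / pi) - 1/2
              - sqrt (2 / (pi * real n)) * ((\<Sum>j=0..K. c j / real n ^ j) + r n)"
    using ev
  proof eventually_elim
    case (elim n)
    have sq: "sqrt (2 * real n / pi) = sqrt (2 / (pi * real n)) * real n"
    proof -
      have "2 * real n / pi = 2 / (pi * real n) * (real n)\<^sup>2" using elim by (simp add: power2_eq_square)
      thus ?thesis by (simp only: real_sqrt_mult real_sqrt_abs abs_of_nat)
    qed
    have "(\<Sum>k<K+2. F $ k * recip n ^ k) = F $ 0 + (\<Sum>j<Suc K. F $ Suc j * recip n ^ Suc j)"
      by (simp add: sum.lessThan_Suc_shift del: sum.lessThan_Suc power_Suc)
    hence "real n * (\<Sum>k<K+2. F $ k * recip n ^ k) = real n + (\<Sum>j<Suc K. real n * (F $ Suc j * recip n ^ Suc j))"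
      by (simp only: F0 distrib_left sum_distrib_left mult_1_right)
    also have "(\<Sum>j<Suc K. real n * (F $ Suc j * recip n ^ Suc j)) = (\<Sum>j=0..K. - (c j / real n ^ j))"
      using elim by (intro sum.cong) (auto simp: c power_one_over)
    finally have "real n * normalized_gain n = real n - ((\<Sum>j=0..K. c j / real n ^ j) + r n)"
      by (simp add: r_def e_def algebra_simps sum_negf)
    moreover have "expected_correct n = real n / 2 - 1 / 2 + sqrt (2 * real n / pi) * normalized_gain n"
      using elim by (simp add: normalized_gain_def)
    hence "expected_correct n = real n / 2 - 1 / 2 + sqrt (2 / (pi * real n)) * (real n * normalized_gain n)"
      by (simp only: sq mult.assoc)
    ultimately show ?case unfolding sq by (simp only:) (simp add: algebra_simps)
  qed
  ultimately show ?thesis by blast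
qed

theorem mainTheorem1:
  shows "\<exists>c d :: nat \<Rightarrow> real.
    c 0 = 3/4 \<and> c 1 = 53/96 \<and> c 2 = 443/384 \<and> c 3 = 75949/18432 \<and> c 4 = 4621519/221184 \<and>
    d 0 = 3/4 \<and> d 1 = 49/96 \<and> d 2 = 439/384 \<and> d 3 = 76709/18432 \<and> d 4 = 4628519/221184 \<and>
    (\<forall>K::nat.
      (\<exists>r \<in> O[at_top \<sqinter> principal {n::nat. odd n}](\<lambda>n. 1 / real n ^ (K + 1)).
        \<forall>\<^sub>F n in at_top \<sqinter> principal {n::nat. odd n}.
          expected_correct n =
            real n / 2 + sqrt (2 * real n / pi) - 1/2
              - sqrt (2 / (pi * real n)) * ((\<Sum>j=0..K. c j / real n ^ j) + r n)) \<and>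
      (\<exists>r \<in> O[at_top \<sqinter> principal {n::nat. even n}](\<lambda>n. 1 / real n ^ (K + 1)).
        \<forall>\<^sub>F n in at_top \<sqinter> principal {n::nat. even n}.
          expected_correct n =
            real n / 2 + sqrt (2 * real n / pi) - 1/2
              - sqrt (2 / (pi * real n)) * ((\<Sum>j=0..K. d j / real n ^ j) + r n)))"
proof -
  obtain F where F: "expands (\<lambda>m. recip (2 * m + 1)) (\<lambda>m. normalized_gain (2 * m + 1)) F" "F $ 0 = 1"
     "F $ 1 = -3/4" "F $ 2 = -53/96" "F $ 3 = -443/384" "F $ 4 = -75949/18432" "F $ 5 = -4621519/221184"
    using normalized_gain_odd_expands by blast
  obtain G where G: "expands (\<lambda>m. recip (2 * m)) (\<lambda>m. normalized_gain (2 * m)) G" "G $ 0 = 1"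
     "G $ 1 = -3/4" "G $ 2 = -49/96" "G $ 3 = -439/384" "G $ 4 = -76709/18432" "G $ 5 = -4628519/221184"
    using normalized_gain_even_expands by blast
  define c where "c = (\<lambda>j. - F $ Suc j)"
  define d where "d = (\<lambda>j. - G $ Suc j)"
  have c: "c 0 = 3/4" "c 1 = 53/96" "c 2 = 443/384" "c 3 = 75949/18432" "c 4 = 4621519/221184"
    using F by (simp_all add: c_def numeral_eq_Suc)
  have d: "d 0 = 3/4" "d 1 = 49/96" "d 2 = 439/384" "d 3 = 76709/18432" "d 4 = 4628519/221184"
    using G by (simp_all add: d_def numeral_eq_Suc)
  have odd: "\<exists>m. n = 2 * m + 1" if "n \<in> {n. odd n}" for n :: nat using that by (auto elim: oddE)
  have even: "\<exists>m. n = 2 * m + 0" if "n \<in> {n. even n}" for n :: nat using that by (auto elim: evenE)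
  have G': "expands (\<lambda>m. recip (2 * m + 0)) (\<lambda>m. normalized_gain (2 * m + 0)) G" using G(1) by simp
  have cF: "c j = - F $ Suc j" for j by (simp add: c_def)
  have dG: "d j = - G $ Suc j" for j by (simp add: d_def)
  show ?thesis
    by (intro exI[of _ c] exI[of _ d] conjI allI c d expected_correct_expansion[OF F(1,2) odd cF]
          expected_correct_expansion[OF G' G(2) even dG])
qed

end
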